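(* Consider the binomial thinning structural equation model on a DAG $G=(V,E)$, $V=\{1,\dots,d\}$, $$X_i=\sum_{j\in\operatorname{pa}_G(i)}\alpha_{ij}\circ_b X_j+\varepsilon_i,\qquad i\in V,$$ with $\alpha_{ij}\in(0,1]$ for $j\to i\in E$, where the mutually independent count-valued exogenous variables $\varepsilon_1,\dots,\varepsilon_d$ satisfy, for every $i\in V$: (A1) $\Pr(\varepsilon_i=0)>0$; (A2) $\operatorname{Var}(\varepsilon_i)>0$; (A3) $\mathbb E[e^{t\varepsilon_i}]<\infty$ for $t$ in a neighborhood of zero. If $\varepsilon_i$ is non-Poisson for every nonsink $i$ in $G$, then the observational distribution of $\boldsymbol X=(X_1,\dots,X_d)^\top$ uniquely determines $G$, the thinning coefficient matrix $\boldsymbol A=(\alpha_{ij})_{i,j\in V}$, and the node-wise exogenous distributions. That is, if two such models on $V$ (with possibly different DAGs), both satisfying all of these hypotheses, induce the same distribution of $\boldsymbol X$, then they have the same DAG, the same matrix $\boldsymbol A$, and, for each $i$, the same distribution of $\varepsilon_i$.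
   Context: $\mathbb N_0=\{0,1,2,\dots\}$; count-valued means $\mathbb N_0$-valued. Binomial thinning: for a $\mathbb N_0$-valued random variable $X$ and $\alpha\in[0,1]$, $\alpha\circ_bX=\sum_{\ell=1}^{X}B_\ell$ with $B_1,B_2,\dots$ i.i.d. $\mathrm{Bernoulli}(\alpha)$ independent of $X$ (the empty sum is $0$). In the model, all Bernoulli offspring variables associated with the terms $\alpha_{ij}\circ_bX_j$ (over all edges) are mutually independent and independent of $\{\varepsilon_i:i\in V\}$; the distribution families of the $\varepsilon_i$ may differ across nodes. $\operatorname{pa}_G(i)$ is the parent set of $i$. Convention: $\alpha_{ij}=0$ whenever $j\notin\operatorname{pa}_G(i)$. A nonsink is a node having at least one child in $G$. "Non-Poisson" means that the distribution is not $\mathrm{Poisson}(\lambda)$ for any $\lambda>0$. *)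

theory Defs
  imports "HOL-Probability.Probability"
begin

text \<open>
  Edges are pairs: \<open>(j, i) \<in> E\<close> stands for the edge \<open>j \<rightarrow> i\<close>.
\<close>

definition pa :: "(nat \<times> nat) set \<Rightarrow> nat \<Rightarrow> nat set" where
  "pa E i = {j. (j, i) \<in> E}"

definition nonsink :: "(nat \<times> nat) set \<Rightarrow> nat \<Rightarrow> bool" where
  "nonsink E i \<longleftrightarrow> (\<exists>k. (i, k) \<in> E)"

definition law :: "'a measure \<Rightarrow> ('a \<Rightarrow> nat) \<Rightarrow> nat measure" where
  "law M Y = distr M (count_space UNIV) Y"

definition poisson_distributed :: "'a measure \<Rightarrow> ('a \<Rightarrow> nat) \<Rightarrow> bool" where
  "poisson_distributed M Y \<longleftrightarrow> (\<exists>r>0. law M Y = measure_pmf (poisson_pmf r))"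

definition bernoulli_distributed :: "'a measure \<Rightarrow> real \<Rightarrow> ('a \<Rightarrow> nat) \<Rightarrow> bool" where
  "bernoulli_distributed M p Y \<longleftrightarrow> law M Y = measure_pmf (map_pmf of_bool (bernoulli_pmf p))"

text \<open>
  The binomial thinning of \<open>Y\<close> with offspring variables \<open>B 1, B 2, \<dots>\<close>.  The thinning
  coefficient enters through the law of the offspring variables, which is fixed together
  with their independence in the model below.
\<close>

definition thinning :: "(nat \<Rightarrow> 'a \<Rightarrow> nat) \<Rightarrow> ('a \<Rightarrow> nat) \<Rightarrow> 'a \<Rightarrow> nat" where
  "thinning B Y \<omega> = (\<Sum>l = 1..Y \<omega>. B l \<omega>)"

text \<open>
  \<open>B i j l\<close> is the \<open>l\<close>-th offspring variable of the thinning of \<open>X j\<close> in the equation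
  for \<open>X i\<close>.  Exogenous and offspring variables are jointly independent as one family.
  By acyclicity, every \<open>X j\<close> is almost surely a function of exogenous variables and of
  offspring variables of edges into \<open>j\<close> or into ancestors of \<open>j\<close>, so the offspring
  variables \<open>B i j\<close> of an edge \<open>j \<rightarrow> i\<close> are independent of \<open>X j\<close>, as the definition of
  binomial thinning demands.
\<close>

locale binomial_thinning_sem = prob_space M
  for M :: "'a measure" +
  fixes d :: nat
    and E :: "(nat \<times> nat) set"
    and A :: "nat \<Rightarrow> nat \<Rightarrow> real"
    and \<epsilon> :: "nat \<Rightarrow> 'a \<Rightarrow> nat"
    and B :: "nat \<Rightarrow> nat \<Rightarrow> nat \<Rightarrow> 'a \<Rightarrow> nat"
    and X :: "nat \<Rightarrow> 'a \<Rightarrow> nat"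
  assumes edges: "E \<subseteq> {1..d} \<times> {1..d}"
    and dag: "acyclic E"
    and coeff_edge: "\<And>i j. (j, i) \<in> E \<Longrightarrow> 0 < A i j \<and> A i j \<le> 1"
    and coeff_nonedge:
      "\<And>i j. i \<in> {1..d} \<Longrightarrow> j \<in> {1..d} \<Longrightarrow> j \<notin> pa E i \<Longrightarrow> A i j = 0"
    and noise_indep:
      "indep_vars (\<lambda>_. count_space UNIV)
         (\<lambda>k. case k of Inl i \<Rightarrow> \<epsilon> i | Inr (i, j, l) \<Rightarrow> B i j l)
         ({1..d} <+> {(i, j, l). (j, i) \<in> E \<and> 1 \<le> l})"
    and offspring_bernoulli:
      "\<And>i j l. (j, i) \<in> E \<Longrightarrow> 1 \<le> l \<Longrightarrow> bernoulli_distributed M (A i j) (B i j l)"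
    and X_measurable: "\<And>i. i \<in> {1..d} \<Longrightarrow> random_variable (count_space UNIV) (X i)"
    and structural_equation:
      "\<And>i. i \<in> {1..d} \<Longrightarrow>
         AE \<omega> in M. X i \<omega> = (\<Sum>j\<in>pa E i. thinning (B i j) (X j) \<omega>) + \<epsilon> i \<omega>"
    and A1: "\<And>i. i \<in> {1..d} \<Longrightarrow> \<P>(\<omega> in M. \<epsilon> i \<omega> = 0) > 0"
    and A2: "\<And>i. i \<in> {1..d} \<Longrightarrow> variance (\<lambda>\<omega>. real (\<epsilon> i \<omega>)) > 0"
    and A3: "\<And>i. i \<in> {1..d} \<Longrightarrow>
      \<exists>r>0. \<forall>t. \<bar>t\<bar> < r \<longrightarrow> integrable M (\<lambda>\<omega>. exp (t * real (\<epsilon> i \<omega>)))"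

definition observational_law ::
    "'a measure \<Rightarrow> nat \<Rightarrow> (nat \<Rightarrow> 'a \<Rightarrow> nat) \<Rightarrow> (nat \<Rightarrow> nat) measure" where
  "observational_law M d X =
     distr M (\<Pi>\<^sub>M i\<in>{1..d}. count_space UNIV) (\<lambda>\<omega>. \<lambda>i\<in>{1..d}. X i \<omega>)"

end

theory Submission
  imports Defs
begin

text \<open>
  With \<open>g i\<close> the probability generating function of \<open>\<epsilon> i\<close>, the joint generating function of \<open>X\<close> is
  \<open>\<Prod>i. g i (u i)\<close>, where \<open>u i = s i * (\<Prod>k. 1 - A k i + A k i * u k)\<close> over the children \<open>k\<close> of \<open>i\<close>.
  Suppose that \<open>i\<close> is a sink of one model but has a child \<open>k\<close> in another model with the same joint
  generating function.  Freezing all arguments except \<open>s i = a\<close> and \<open>s k = t\<close> at 0 or 1 gives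
  \<open>\<rho> a * g k (t * P a) = D * g' k (c * t) * g' i (a * (w + z * t))\<close> with a polynomial \<open>P\<close>.  Comparing
  the Taylor coefficients of order 0, 1, 2 at \<open>t = 0\<close> and then degrees in \<open>a\<close>, the logarithmic
  derivative of \<open>g' i\<close> must be constant, so \<open>\<epsilon>' i\<close> is Poisson, which is excluded.
  Hence the models share a sink.  Removing it leaves two models with equal joint generating functions
  on fewer nodes, and the law and coefficients of the sink itself are read off by evaluating at 0, 1/2 and 1.
\<close>

section \<open>Generating functions of distributions on the natural numbers\<close>

text \<open>Defined for arbitrary real sequences, because it is also applied to
  \<open>diffs p\<close> and to differences of mass functions.\<close>

definition pgf :: "(nat \<Rightarrow> real) \<Rightarrow> real \<Rightarrow> real" where
  "pgf p x = (\<Sum>n. p n * x ^ n)"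

text \<open>The trace of (A1) and (A2) on a mass function: mass at 0 keeps \<open>pgf p\<close>
  positive on [0, 1], and mass at some positive integer makes it strictly increasing there.\<close>

definition nondeg_mass :: "(nat \<Rightarrow> real) \<Rightarrow> bool" where
  "nondeg_mass p \<longleftrightarrow> (\<forall>n. 0 \<le> p n) \<and> p sums 1 \<and> 0 < p 0 \<and> (\<exists>n>0. 0 < p n)"

definition poisson_mass :: "(nat \<Rightarrow> real) \<Rightarrow> bool" where
  "poisson_mass p \<longleftrightarrow> (\<exists>r>0. \<forall>n. p n = r ^ n / fact n * exp (- r))"

lemma pgf_0 [simp]: "pgf p 0 = p 0"
  unfolding pgf_def by (rule powser_zero)

lemma summable_pgf:
  assumes "nondeg_mass p" "\<bar>x\<bar> \<le> 1"
  shows "summable (\<lambda>n. p n * x ^ n)"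
proof (rule summable_comparison_test)
  show "summable p" using assms by (auto simp: nondeg_mass_def sums_iff)
  show "\<exists>N. \<forall>n\<ge>N. norm (p n * x ^ n) \<le> p n"
    using assms by (auto simp: nondeg_mass_def abs_mult power_abs intro!: mult_left_le power_le_one)
qed

lemma pgf_1: "nondeg_mass p \<Longrightarrow> pgf p 1 = 1"
  by (simp add: pgf_def nondeg_mass_def sums_iff)

lemma pgf_mono:
  assumes "nondeg_mass p" "0 \<le> x" "x \<le> y" "y \<le> 1"
  shows "pgf p x \<le> pgf p y"
  unfolding pgf_def
  using assms by (intro suminf_le summable_pgf) (auto simp: nondeg_mass_def intro!: mult_left_mono power_mono)

lemma pgf_strict_mono:
  assumes "nondeg_mass p" "0 \<le> x" "x < y" "y \<le> 1"
  shows "pgf p x < pgf p y"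
proof -
  obtain m where m: "m > 0" "0 < p m" using assms by (auto simp: nondeg_mass_def)
  have s: "summable (\<lambda>n. p n * y ^ n - p n * x ^ n)"
    using assms by (intro summable_diff summable_pgf) auto
  have "0 < (\<Sum>n. p n * y ^ n - p n * x ^ n)"
  proof (rule suminf_pos2[OF s])
    show "0 \<le> p n * y ^ n - p n * x ^ n" for n
      using assms by (auto simp: nondeg_mass_def intro!: mult_left_mono power_mono)
    show "0 < p m * y ^ m - p m * x ^ m"
      using assms m by (auto intro!: power_strict_mono)
  qed
  also have "\<dots> = pgf p y - pgf p x"
    unfolding pgf_def using assms by (intro suminf_diff[symmetric] summable_pgf) auto
  finally show ?thesis by simp
qed

lemma pgf_pos:
  assumes "nondeg_mass p" "0 \<le> x" "x \<le> 1"
  shows "0 < pgf p x"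
  using pgf_mono[OF assms(1) order_refl assms(2,3)] assms(1) by (simp add: nondeg_mass_def)

text \<open>Summability is assumed only inside the unit disc, so that the lemma applies again to
  \<open>diffs c\<close> and yields second derivatives.\<close>

lemma pgf_deriv:
  assumes "\<And>x. \<bar>x\<bar> < 1 \<Longrightarrow> summable (\<lambda>n. c n * x ^ n)" "\<bar>x\<bar> < 1"
  shows "(pgf c has_real_derivative pgf (diffs c) x) (at x)"
    "summable (\<lambda>n. diffs c n * x ^ n)"
proof -
  obtain K where K: "\<bar>x\<bar> < K" "K < 1" using assms(2) dense by blast
  have "summable (\<lambda>n. c n * K ^ n)" using assms(1)[of K] K by auto
  from termdiffs_strong[OF this, of x] K show "(pgf c has_real_derivative pgf (diffs c) x) (at x)"
    by (simp add: pgf_def[abs_def])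
  show "summable (\<lambda>n. diffs c n * x ^ n)"
    by (rule termdiff_converges[of x 1]) (use assms in auto)
qed

text \<open>Dividing by the lowest power with a nonzero coefficient leaves a series \<open>b\<close>
  that is continuous at 0 and vanishes to the right of 0, so its constant term is 0.\<close>

lemma powser_eq_0_imp:
  fixes c :: "nat \<Rightarrow> real"
  assumes "0 < w" "\<And>x. \<bar>x\<bar> < w \<Longrightarrow> summable (\<lambda>n. c n * x ^ n)"
    and "\<And>x. 0 < x \<Longrightarrow> x < w \<Longrightarrow> pgf c x = 0"
  shows "c n = 0"
proof (rule ccontr)
  assume n: "c n \<noteq> 0"
  then obtain m where m: "c m \<noteq> 0" "\<And>i. i < m \<Longrightarrow> c i = 0"
    using exists_least_iff[of "\<lambda>n. c n \<noteq> 0"] by blast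
  define b where "b i = c (i + m)" for i
  have sm: "summable (\<lambda>n. b n * x ^ n)" and eq: "pgf c x = x ^ m * pgf b x"
    if x: "0 < x" "x < w" for x
  proof -
    have s: "summable (\<lambda>n. c n * x ^ n)" using assms(2) x by simp
    from summable_ignore_initial_segment[OF this, of m]
    have s': "summable (\<lambda>n. x ^ m * (b n * x ^ n))" by (simp add: b_def power_add mult_ac)
    then show sb: "summable (\<lambda>n. b n * x ^ n)" using x by (simp add: summable_cmult_iff)
    have "pgf c x = (\<Sum>n. c (n + m) * x ^ (n + m)) + (\<Sum>i<m. c i * x ^ i)"
      unfolding pgf_def by (rule suminf_split_initial_segment[OF s])
    also have "\<dots> = (\<Sum>n. x ^ m * (b n * x ^ n))" using m(2) by (simp add: b_def power_add mult_ac)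
    also have "\<dots> = x ^ m * pgf b x" unfolding pgf_def by (rule suminf_mult[OF sb])
    finally show "pgf c x = x ^ m * pgf b x" .
  qed
  define v where "v = w / 2"
  have v: "0 < v" "v < w" using assms(1) by (auto simp: v_def)
  have "isCont (pgf b) 0"
    unfolding pgf_def[abs_def] using isCont_powser[OF sm[OF v], of 0] v by simp
  then have "(pgf b \<longlongrightarrow> b 0) (at_right 0)"
    unfolding isCont_def using tendsto_mono[OF at_le[of "{0<..}" UNIV]] by fastforce
  moreover have "eventually (\<lambda>x. pgf b x = 0) (at_right 0)"
    using eventually_at_right_less[of "0::real"] eventually_at_right_real[OF v(1)]
  proof eventually_elim
    case (elim x)
    then have "x < w" using v by auto
    with eq[of x] assms(3)[of x] elim show ?case by simp
  qed
  then have "(pgf b \<longlongrightarrow> 0) (at_right 0)" by (rule tendsto_eventually)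
  ultimately have "b 0 = 0" using tendsto_unique trivial_limit_at_right_real by blast
  with m show False by (simp add: b_def)
qed

lemma pgf_inject:
  assumes "nondeg_mass p" "nondeg_mass q" "\<And>x. 0 < x \<Longrightarrow> x < 1 \<Longrightarrow> pgf p x = pgf q x"
  shows "p = q"
proof
  fix n
  have "(\<lambda>n. p n - q n) n = 0"
  proof (rule powser_eq_0_imp[of 1])
    show "summable (\<lambda>n. (p n - q n) * x ^ n)" if "\<bar>x\<bar> < 1" for x
      using summable_diff[OF summable_pgf[OF assms(1)] summable_pgf[OF assms(2)], of x x] that
      by (simp add: algebra_simps)
    show "pgf (\<lambda>n. p n - q n) x = 0" if "0 < x" "x < 1" for x
      using suminf_diff[OF summable_pgf[OF assms(1)] summable_pgf[OF assms(2)], of x x] that assms(3)[of x]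
      by (simp add: algebra_simps pgf_def)
  qed simp
  then show "p n = q n" by simp
qed

text \<open>The differential equation passes to coefficients as
  \<open>p (Suc n) = r * p n / Suc n\<close>, so \<open>p n\<close> is
  \<open>p 0 * (r ^ n / fact n)\<close>; total mass 1 fixes \<open>p 0\<close>, and mass off 0
  excludes r = 0.\<close>

lemma poisson_massI:
  assumes p: "nondeg_mass p" and w: "0 < w" "w < 1"
    and eq: "\<And>x. 0 < x \<Longrightarrow> x < w \<Longrightarrow> pgf (diffs p) x = r * pgf p x"
  shows "poisson_mass p"
proof -
  have sm: "summable (\<lambda>n. p n * x ^ n)" if "\<bar>x\<bar> < 1" for x using summable_pgf[OF p] that by simp
  note sd = pgf_deriv(2)[OF sm]
  have "(\<lambda>n. diffs p n - r * p n) n = 0" for n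
  proof (rule powser_eq_0_imp[OF w(1)])
    fix x :: real
    show "summable (\<lambda>n. (diffs p n - r * p n) * x ^ n)" if "\<bar>x\<bar> < w"
      using summable_diff[OF sd summable_mult[OF sm], of x x r] that w by (simp add: algebra_simps)
    show "pgf (\<lambda>n. diffs p n - r * p n) x = 0" if "0 < x" "x < w"
      using suminf_diff[OF sd summable_mult[OF sm], of x x r] suminf_mult[OF sm, of x r] that w eq[of x]
      by (simp add: algebra_simps pgf_def)
  qed
  then have rec: "p (Suc n) = r * p n / Suc n" for n
    by (simp add: diffs_def field_simps del: of_nat_Suc)
  have pn: "p n = p 0 * (r ^ n / fact n)" for n
  proof (induction n)
    case (Suc n)
    then show ?case unfolding rec by (simp add: fact_Suc mult_ac)
  qed simp
  have "(\<lambda>n. p 0 * (r ^ n / fact n)) sums (p 0 * exp r)"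
    by (rule sums_mult) (use exp_converges[of r] in \<open>simp add: divide_inverse mult.commute\<close>)
  then have "p sums (p 0 * exp r)" unfolding pn[symmetric] .
  then have "p 0 * exp r = 1" using p by (auto simp: nondeg_mass_def sums_iff)
  then have p0: "p 0 = exp (- r)" by (simp add: exp_minus field_simps)
  have "0 \<le> p 1" "0 < p 0" using p by (simp_all add: nondeg_mass_def)
  then have "0 \<le> r" using rec[of 0] by (simp add: zero_le_mult_iff)
  moreover have "r \<noteq> 0"
  proof
    assume "r = 0"
    then have "p n = 0" if "n > 0" for n using pn[of n] that by simp
    then show False using p by (auto simp: nondeg_mass_def)
  qed
  ultimately show ?thesis unfolding poisson_mass_def using pn p0 by (intro exI[of _ r]) (simp add: mult.commute)
qed

section \<open>A functional equation with a polynomial fibre that forces a Poisson law\<close>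

text \<open>The first equation forces \<open>degree P = degree q\<close>; if this is at least 2, the left side of the second
  equation is zero or of degree \<open>2 * degree q\<close>, but the right side has degree \<open>degree q\<close>.\<close>
lemma degree_le_1_of_square_eq:
  fixes P q :: "real poly"
  assumes aP: "smult a P = [:e:] + smult \<mu> q" and "\<mu> \<noteq> 0"
    and bP: "smult b (P ^ 2) = [:e':] + smult \<nu> (pCons 0 (pderiv q) - q)" and "\<nu> \<noteq> 0"
  shows "degree q \<le> 1"
proof (rule ccontr)
  define n where "n = degree q"
  define T where "T = [:e':] + smult \<nu> (pCons 0 (pderiv q) - q)"
  assume "\<not> degree q \<le> 1"
  then have n: "n \<ge> 2" by (simp add: n_def)
  have lc: "coeff q n \<noteq> 0" using n by (auto simp: n_def)
  \<comment> \<open>Passing from q to x q' multiplies the coefficient at m by m, so the coefficient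
    at n \<ge> 2 survives the subtraction of q.\<close>
  have cT: "coeff T m = \<nu> * ((real m - 1) * coeff q m)" if "m > 0" for m
    using that by (cases m) (auto simp: T_def coeff_pderiv algebra_simps)
  have Tn: "coeff T n \<noteq> 0" using cT[of n] n lc \<open>\<nu> \<noteq> 0\<close> by auto
  have T2: "coeff T (2 * n) = 0" using cT[of "2 * n"] n by (simp add: n_def coeff_eq_0)
  have P: "smult b (P ^ 2) = T" using bP by (simp add: T_def)
  have "degree ([:e:] + smult \<mu> q) = n"
    using n \<open>\<mu> \<noteq> 0\<close> by (subst degree_add_eq_right) (auto simp: n_def)
  then have "degree (smult a P) = n" by (simp add: aP)
  then have dP: "degree P = n" using n by (cases "a = 0") auto
  have "b \<noteq> 0" using P Tn by auto
  then have "degree T = n * 2" using P[symmetric] dP n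
    by (cases "P = 0") (auto simp: power2_eq_square degree_mult_eq)
  moreover have "T \<noteq> 0" using Tn by auto
  ultimately show False using T2 by (metis leading_coeff_0_iff mult.commute)
qed

lemma poly_eq_of_eq_on_unit_interval:
  fixes p q :: "real poly"
  assumes "\<And>s. 0 < s \<Longrightarrow> s < 1 \<Longrightarrow> poly p s = poly q s"
  shows "p = q"
proof (rule ccontr)
  assume "p \<noteq> q"
  then have "finite {x. poly (p - q) x = 0}" by (intro poly_roots_finite) simp
  moreover have "{0<..<1} \<subseteq> {x. poly (p - q) x = 0}" using assms by auto
  ultimately have "finite {0<..<(1::real)}" by (rule rev_finite_subset)
  then show False by (simp add: infinite_Ioo)
qed

text \<open>Write h for \<open>pgf h\<close>. Order 0 in t expresses \<open>\<rho> s\<close> through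
  h. With this divided out, order 1 makes x h'(x) / h(x) at x = s w a polynomial q in s that is
  affine in P, and order 2 does the same for x^2 h''(x) / h(x) with a polynomial quadratic in P.
  Differentiation ties the two together and bounds the degree of q by 1; since q(0) = 0, the
  quotient h' / h is constant.\<close>

lemma poisson_mass_of_polynomial_fibre:
  fixes P :: "real poly"
  assumes f: "nondeg_mass f" and g: "nondeg_mass g" and h: "nondeg_mass h"
    and w: "0 < w" "w < 1" and z: "0 < z" and D: "0 < D"
    and eq: "\<And>s t. 0 < s \<Longrightarrow> s < 1 \<Longrightarrow> \<bar>t\<bar> \<le> 1 \<Longrightarrow>
      \<rho> s * pgf f (t * poly P s) = D * pgf g (c * t) * pgf h (s * (w + z * t))"
  shows "poisson_mass h"
proof -
  have sf: "\<And>x. \<bar>x\<bar> < 1 \<Longrightarrow> summable (\<lambda>n. f n * x ^ n)"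
    and sg: "\<And>x. \<bar>x\<bar> < 1 \<Longrightarrow> summable (\<lambda>n. g n * x ^ n)"
    and sh: "\<And>x. \<bar>x\<bar> < 1 \<Longrightarrow> summable (\<lambda>n. h n * x ^ n)"
    using summable_pgf[OF f] summable_pgf[OF g] summable_pgf[OF h] by simp_all
  note d1 = pgf_deriv[OF sf] pgf_deriv[OF sg] pgf_deriv[OF sh]
  note d2 = pgf_deriv(1)[OF d1(2)] pgf_deriv(1)[OF d1(4)] pgf_deriv(1)[OF d1(6)]
  let ?f1 = "pgf (diffs f)" and ?f2 = "pgf (diffs (diffs f))"
  let ?g1 = "pgf (diffs g)" and ?g2 = "pgf (diffs (diffs g))"
  let ?h1 = "pgf (diffs h)" and ?h2 = "pgf (diffs (diffs h))"
  have pos: "0 < f 0" "0 < g 0" using f g by (auto simp: nondeg_mass_def)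
  have hpos: "0 < pgf h (s * w)" if "0 \<le> s" "s \<le> 1" for s
    using that w by (intro pgf_pos[OF h]) (auto intro: mult_le_one)
  have derivs: "\<rho> s * f 0 = D * g 0 * pgf h (s * w)"
    "\<rho> s * poly P s * diffs f 0 = D * (c * diffs g 0 * pgf h (s * w) + g 0 * (s * z) * ?h1 (s * w))"
    "\<rho> s * (poly P s)\<^sup>2 * diffs (diffs f) 0 = D * (c\<^sup>2 * diffs (diffs g) 0 * pgf h (s * w)
        + 2 * c * diffs g 0 * (s * z) * ?h1 (s * w) + g 0 * (s * z)\<^sup>2 * ?h2 (s * w))"
    if s: "0 < s" "s < 1" for s
  proof -
    let ?L = "\<lambda>t. \<rho> s * pgf f (t * poly P s)"
    let ?R = "\<lambda>t. D * pgf g (c * t) * pgf h (s * (w + z * t))"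
    let ?L1 = "\<lambda>t. \<rho> s * poly P s * ?f1 (t * poly P s)"
    let ?R1 = "\<lambda>t. D * (c * ?g1 (c * t) * pgf h (s * (w + z * t)) + pgf g (c * t) * (s * z) * ?h1 (s * (w + z * t)))"
    \<comment> \<open>On this open neighbourhood of 0 every argument stays inside the unit disc, so
      both sides can be differentiated in t.\<close>
    define S where "S = {t. \<bar>t\<bar> < 1} \<inter> {t. \<bar>t * poly P s\<bar> < 1} \<inter> {t. \<bar>c * t\<bar> < 1} \<inter> {t. \<bar>s * (w + z * t)\<bar> < 1}"
    have oS: "open S" unfolding S_def by (intro open_Int open_Collect_less continuous_intros)
    have "s * w < 1" using mult_strict_mono[of s 1 w 1] s w by simp
    then have S0: "0 \<in> S" using s w by (simp add: S_def)
    have LR: "?L t = ?R t" if "t \<in> S" for t using eq[OF s] that by (simp add: S_def)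
    have dL: "(?L has_real_derivative ?L1 t) (at t)" and dR: "(?R has_real_derivative ?R1 t) (at t)"
      if "t \<in> S" for t
      using that
      by (auto simp: S_def algebra_simps intro!: derivative_eq_intros DERIV_chain2[OF d1(1)] DERIV_chain2[OF d1(3)] DERIV_chain2[OF d1(5)])
    have LR1: "?L1 t = ?R1 t" if t: "t \<in> S" for t
      by (rule DERIV_unique[OF _ dR[OF t]])
        (rule has_field_derivative_transform_within_open[OF dL[OF t] oS t LR])
    have dL1: "(?L1 has_real_derivative \<rho> s * (poly P s)\<^sup>2 * ?f2 0) (at 0)"
      by (auto simp: power2_eq_square intro!: derivative_eq_intros DERIV_chain2[OF d2(1)])
    have dR1: "(?R1 has_real_derivative D * (c\<^sup>2 * ?g2 0 * pgf h (s * w)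
        + 2 * c * ?g1 0 * (s * z) * ?h1 (s * w) + pgf g 0 * (s * z)\<^sup>2 * ?h2 (s * w))) (at 0)"
      using S0
      by (auto simp: S_def algebra_simps power2_eq_square intro!: derivative_eq_intros DERIV_chain2[OF d2(2)]
          DERIV_chain2[OF d2(3)] DERIV_chain2[OF d1(3)] DERIV_chain2[OF d1(5)])
    have LR2: "\<rho> s * (poly P s)\<^sup>2 * ?f2 0 = D * (c\<^sup>2 * ?g2 0 * pgf h (s * w)
        + 2 * c * ?g1 0 * (s * z) * ?h1 (s * w) + pgf g 0 * (s * z)\<^sup>2 * ?h2 (s * w))"
      by (rule DERIV_unique[OF _ dR1])
        (rule has_field_derivative_transform_within_open[OF dL1 oS S0 LR1])
    show "\<rho> s * f 0 = D * g 0 * pgf h (s * w)" using LR[OF S0] by simp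
    show "\<rho> s * poly P s * diffs f 0 = D * (c * diffs g 0 * pgf h (s * w) + g 0 * (s * z) * ?h1 (s * w))"
      using LR1[OF S0] by simp
    show "\<rho> s * (poly P s)\<^sup>2 * diffs (diffs f) 0 = D * (c\<^sup>2 * diffs (diffs g) 0 * pgf h (s * w)
        + 2 * c * diffs g 0 * (s * z) * ?h1 (s * w) + g 0 * (s * z)\<^sup>2 * ?h2 (s * w))"
      using LR2 by simp
  qed
  \<comment> \<open>Derivatives at 0 divided by the values at 0, for \<open>pgf f\<close> and for
    \<open>pgf g (c * t)\<close> as a function of t.\<close>
  define a where "a = diffs f 0 / f 0"
  define b where "b = diffs (diffs f) 0 / f 0"
  define e1 where "e1 = c * diffs g 0 / g 0"
  define e2 where "e2 = c\<^sup>2 * diffs (diffs g) 0 / g 0"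
  \<comment> \<open>\<open>\<kappa>\<close> rescales s z to s w. With x = s w, \<open>q\<close> is
    to represent x h'(x) / h(x) and \<open>r\<close> to represent x^2 h''(x) / h(x).\<close>
  define \<kappa> where "\<kappa> = w / z"
  define q where "q = smult \<kappa> (smult a P - [:e1:])"
  define r where "r = smult (\<kappa>\<^sup>2) (smult b (P ^ 2) - [:e2:] - smult (2 * e1) (smult a P - [:e1:]))"
  have kz: "\<kappa> * z = w" and kp: "0 < \<kappa>" using z w by (simp_all add: \<kappa>_def)
  have A: "poly q s * pgf h (s * w) = s * w * ?h1 (s * w)"
    and R: "poly r s * pgf h (s * w) = s\<^sup>2 * w\<^sup>2 * ?h2 (s * w)" if s: "0 < s" "s < 1" for s
  proof -
    define H where "H = pgf h (s * w)"
    define H1 where "H1 = ?h1 (s * w)"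
    define H2 where "H2 = ?h2 (s * w)"
    define p where "p = poly P s"
    have f1: "diffs f 0 = a * f 0" and f2: "diffs (diffs f) 0 = b * f 0"
      and g1: "c * diffs g 0 = e1 * g 0" and g2: "c\<^sup>2 * diffs (diffs g) 0 = e2 * g 0"
      using pos by (simp_all add: a_def b_def e1_def e2_def)
    note dd = derivs[OF s, folded H_def H1_def H2_def p_def]
    have Dg: "D * g 0 \<noteq> 0" using D pos by simp
    have "(D * g 0) * (a * p * H) = (\<rho> s * f 0) * (a * p)" using dd(1) by simp
    also have "\<dots> = \<rho> s * p * diffs f 0" by (simp add: f1)
    also have "\<dots> = (D * g 0) * (e1 * H + s * z * H1)" using dd(2) g1 by (simp add: algebra_simps)
    finally have 1: "a * p * H = e1 * H + s * z * H1" using Dg mult_left_cancel by blast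
    have "(D * g 0) * (b * p\<^sup>2 * H) = (\<rho> s * f 0) * (b * p\<^sup>2)" using dd(1) by simp
    also have "\<dots> = \<rho> s * p\<^sup>2 * diffs (diffs f) 0" by (simp add: f2)
    also have "\<dots> = D * ((c\<^sup>2 * diffs (diffs g) 0) * H + 2 * (c * diffs g 0) * (s * z) * H1 + g 0 * (s * z)\<^sup>2 * H2)"
      using dd(3) by (simp add: mult.assoc)
    also have "\<dots> = (D * g 0) * (e2 * H + 2 * e1 * (s * z * H1) + (s * z)\<^sup>2 * H2)"
      unfolding g1 g2 by (simp add: algebra_simps)
    finally have 2: "b * p\<^sup>2 * H = e2 * H + 2 * e1 * (s * z * H1) + (s * z)\<^sup>2 * H2" using Dg mult_left_cancel by blast
    have "poly q s * H = \<kappa> * (a * p * H - e1 * H)" by (simp add: q_def p_def algebra_simps)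
    also have "\<dots> = s * w * H1" unfolding 1 kz[symmetric] by (simp add: algebra_simps)
    finally show "poly q s * pgf h (s * w) = s * w * ?h1 (s * w)" by (simp add: H_def H1_def)
    have "poly r s * H = \<kappa>\<^sup>2 * (b * p\<^sup>2 * H - e2 * H - 2 * e1 * (a * p * H - e1 * H))"
      by (simp add: r_def p_def algebra_simps)
    also have "\<dots> = s\<^sup>2 * w\<^sup>2 * H2" unfolding 1 2 kz[symmetric] by (simp add: algebra_simps power2_eq_square)
    finally show "poly r s * pgf h (s * w) = s\<^sup>2 * w\<^sup>2 * ?h2 (s * w)" by (simp add: H_def H2_def)
  qed
  \<comment> \<open>Differentiating the identity \<open>A\<close> in s and multiplying by s
    introduces the second derivative of \<open>pgf h\<close>, which \<open>R\<close> rewrites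
    through \<open>r\<close>.\<close>
  have qr: "r = pCons 0 (pderiv q) + q * q - q"
  proof (rule poly_eq_of_eq_on_unit_interval)
    fix s :: real assume s: "0 < s" "s < 1"
    then have sw: "s * w < 1" "0 < s * w" using mult_strict_mono[of s 1 w 1] w by simp_all
    have dl: "((\<lambda>s. poly q s * pgf h (s * w)) has_real_derivative
        poly (pderiv q) s * pgf h (s * w) + poly q s * (w * ?h1 (s * w))) (at s)"
      using sw by (auto intro!: derivative_eq_intros DERIV_chain2[OF d1(5)])
    have dr: "((\<lambda>s. s * w * ?h1 (s * w)) has_real_derivative
        w * ?h1 (s * w) + s * w * (w * ?h2 (s * w))) (at s)"
      using sw by (auto intro!: derivative_eq_intros DERIV_chain2[OF d2(3)])
    have "poly (pderiv q) s * pgf h (s * w) + poly q s * (w * ?h1 (s * w)) = w * ?h1 (s * w) + s * w * (w * ?h2 (s * w))"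
      by (rule DERIV_unique[OF _ dr], rule has_field_derivative_transform_within_open[OF dl, of "{0<..<1}"])
        (use s A in auto)
    then have "s * (poly (pderiv q) s * pgf h (s * w) + poly q s * (w * ?h1 (s * w)))
        = s * (w * ?h1 (s * w) + s * w * (w * ?h2 (s * w)))" by simp
    then have "s * poly (pderiv q) s * pgf h (s * w) + poly q s * (s * w * ?h1 (s * w))
        = s * w * ?h1 (s * w) + s\<^sup>2 * w\<^sup>2 * ?h2 (s * w)" by (simp add: algebra_simps power2_eq_square)
    then have "(s * poly (pderiv q) s + poly q s * poly q s - poly q s - poly r s) * pgf h (s * w) = 0"
      unfolding A[OF s, symmetric] R[OF s, symmetric] by (simp add: algebra_simps)
    then show "poly r s = poly (pCons 0 (pderiv q) + q * q - q) s" using hpos[of s] s by auto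
  qed
  have aP: "smult a P = [:e1:] + smult (1 / \<kappa>) q" using kp by (simp add: q_def)
  \<comment> \<open>Subtracting the square of \<open>aP\<close> from the second-order relation
    cancels \<open>q * q\<close> and leaves the form required by
    \<open>degree_le_1_of_square_eq\<close>.\<close>
  have "smult (b - a\<^sup>2) (P ^ 2) = [:e2 - e1\<^sup>2:] + smult ((1 / \<kappa>)\<^sup>2) (pCons 0 (pderiv q) - q)"
  proof (rule poly_eq_of_eq_on_unit_interval)
    fix s
    define y where "y = a * poly P s - e1"
    have q: "poly q s = \<kappa> * y" by (simp add: q_def y_def)
    have ap: "a * poly P s = e1 + y" by (simp add: y_def)
    have "poly (pCons 0 (pderiv q) - q) s = poly r s - (poly q s)\<^sup>2" unfolding qr by (simp add: power2_eq_square)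
    also have "\<dots> = \<kappa>\<^sup>2 * (b * (poly P s)\<^sup>2 - e2 - 2 * e1 * y - y\<^sup>2)"
      unfolding q power_mult_distrib by (simp add: r_def y_def right_diff_distrib)
    finally have "poly ([:e2 - e1\<^sup>2:] + smult ((1 / \<kappa>)\<^sup>2) (pCons 0 (pderiv q) - q)) s
       = e2 - e1\<^sup>2 + (b * (poly P s)\<^sup>2 - e2 - 2 * e1 * y - y\<^sup>2)" using kp by (simp add: field_simps)
    also have "\<dots> = b * (poly P s)\<^sup>2 - (e1 + y)\<^sup>2" by (simp add: power2_eq_square algebra_simps)
    also have "\<dots> = poly (smult (b - a\<^sup>2) (P ^ 2)) s" unfolding ap[symmetric] by (simp add: algebra_simps power_mult_distrib)
    finally show "poly (smult (b - a\<^sup>2) (P ^ 2)) s = poly ([:e2 - e1\<^sup>2:] + smult ((1 / \<kappa>)\<^sup>2) (pCons 0 (pderiv q) - q)) s" ..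
  qed
  from degree_le_1_of_square_eq[OF aP _ this] have "degree q \<le> 1" using kp by simp
  then have "q = [:coeff q 0, coeff q 1:]"
    by (intro poly_eqI) (auto simp: coeff_pCons coeff_eq_0 split: nat.split)
  then obtain q0 q1 where q: "q = [:q0, q1:]" by blast
  \<comment> \<open>The identity \<open>A\<close> holds only for 0 < s; continuity carries it to s =
    0, where it reads \<open>q0 * h 0 = 0\<close>.\<close>
  have "((\<lambda>s. poly q s * pgf h (s * w) - s * w * ?h1 (s * w)) has_real_derivative
      poly (pderiv q) 0 * h 0 + poly q 0 * (w * diffs h 0) - w * diffs h 0) (at 0)"
    by (auto intro!: derivative_eq_intros DERIV_chain2[OF d1(5)] DERIV_chain2[OF d2(3)])
  from DERIV_isCont[OF this]
  have "((\<lambda>s. poly q s * pgf h (s * w) - s * w * ?h1 (s * w)) \<longlongrightarrow> q0 * h 0) (at_right 0)"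
    by (simp add: isCont_def filterlim_at_split q)
  moreover have "((\<lambda>s. poly q s * pgf h (s * w) - s * w * ?h1 (s * w)) \<longlongrightarrow> 0) (at_right 0)"
    by (rule tendsto_eventually, rule eventually_mono[OF eventually_at_right_real[of 0 1]]) (use A in auto)
  ultimately have "q0 * h 0 = 0" using tendsto_unique trivial_limit_at_right_real by blast
  then have q0: "q0 = 0" using h by (auto simp: nondeg_mass_def)
  show ?thesis
  proof (rule poisson_massI[OF h w])
    fix x :: real assume x: "0 < x" "x < w"
    then have "x / w * q1 * pgf h x = x * ?h1 x" using A[of "x / w"] w by (simp add: q q0)
    then show "?h1 x = q1 / w * pgf h x" using x w by (simp add: field_simps)
  qed
qed

section \<open>Joint generating functions on a directed acyclic graph\<close>

text \<open>Where the coefficient is 1, thinning is the identity and the factor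
  \<open>1 - A i j + A i j * u i\<close> reduces to \<open>u i\<close>, which may vanish; for
  nonnegative \<open>u i\<close> a smaller coefficient keeps it positive.\<close>

definition unit_edges :: "(nat \<times> nat) set \<Rightarrow> (nat \<Rightarrow> nat \<Rightarrow> real) \<Rightarrow> (nat \<times> nat) set" where
  "unit_edges E A = {(j, i) \<in> E. A i j = 1}"

text \<open>Summing out the nodes of the model from the sinks upwards turns the joint generating function
  \<open>\<bbbE> \<Prod>\<^sub>i s\<^sub>i ^ X\<^sub>i\<close> into the product of the generating functions of the \<open>\<epsilon>\<^sub>i\<close> at these points.\<close>
definition pgf_arg :: "(nat \<times> nat) set \<Rightarrow> (nat \<Rightarrow> nat \<Rightarrow> real) \<Rightarrow> (nat \<Rightarrow> real) \<Rightarrow> nat \<Rightarrow> real" where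
  "pgf_arg E A s = wfrec (E\<inverse>) (\<lambda>u i. s i * (\<Prod>k\<in>E `` {i}. 1 - A k i + A k i * u k))"

definition joint_pgf ::
    "nat set \<Rightarrow> (nat \<times> nat) set \<Rightarrow> (nat \<Rightarrow> nat \<Rightarrow> real) \<Rightarrow> (nat \<Rightarrow> nat \<Rightarrow> real) \<Rightarrow> (nat \<Rightarrow> real) \<Rightarrow> real" where
  "joint_pgf V E A p s = (\<Prod>i\<in>V. pgf (p i) (pgf_arg E A s i))"

text \<open>The algebraic shadow of a model, with mass functions in place of random variables. An
  arbitrary finite node set replaces \<open>{1..d}\<close>, so that sinks can be removed.\<close>

locale thinning_dag =
  fixes V :: "nat set" and E :: "(nat \<times> nat) set"
    and A :: "nat \<Rightarrow> nat \<Rightarrow> real" and p :: "nat \<Rightarrow> nat \<Rightarrow> real"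
  assumes finite_V: "finite V"
    and edges: "E \<subseteq> V \<times> V"
    and dag: "acyclic E"
    and coeff_edge: "(j, i) \<in> E \<Longrightarrow> 0 < A i j \<and> A i j \<le> 1"
    and coeff_nonedge: "i \<in> V \<Longrightarrow> j \<in> V \<Longrightarrow> (j, i) \<notin> E \<Longrightarrow> A i j = 0"
    and mass: "i \<in> V \<Longrightarrow> nondeg_mass (p i)"
begin

abbreviation u :: "(nat \<Rightarrow> real) \<Rightarrow> nat \<Rightarrow> real" where
  "u \<equiv> pgf_arg E A"

lemma finite_E: "finite E"
  using finite_V edges finite_subset by blast

lemma finite_children [simp]: "finite (E `` {i})"
  using finite_E by simp

lemma wf_children: "wf (E\<inverse>)"
  using finite_E dag by (rule finite_acyclic_wf_converse)

lemma children_induct [case_names children]: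
  "(\<And>i. (\<And>k. (i, k) \<in> E \<Longrightarrow> P k) \<Longrightarrow> P i) \<Longrightarrow> P i"
  using wf_induct_rule[OF wf_children, of P i] by blast

lemma u_unfold: "u s i = s i * (\<Prod>k\<in>E `` {i}. 1 - A k i + A k i * u s k)"
  unfolding pgf_arg_def by (subst wfrec[OF wf_children]) (auto intro!: prod.cong simp: cut_apply)

lemma u_cong:
  assumes "\<And>k. (i, k) \<in> E\<^sup>* \<Longrightarrow> s k = s' k"
  shows "u s i = u s' i"
  using assms
proof (induction i rule: children_induct)
  case (children i)
  have "u s k = u s' k" if "(i, k) \<in> E" for k
    using children that by (meson converse_rtrancl_into_rtrancl)
  then show ?case using children.prems[of i] by (simp add: u_unfold[of _ i])
qed

lemma u_cong':
  assumes "(i, k) \<notin> E\<^sup>*"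
  shows "u (s(k := a)) i = u (s(k := b)) i"
  using assms by (intro u_cong) auto

lemma not_reach_back: "(i, k) \<in> E\<^sup>* \<Longrightarrow> i \<noteq> k \<Longrightarrow> (k, i) \<notin> E\<^sup>*"
  using dag by (meson acyclic_impl_antisym_rtrancl antisymD)

lemma child_not_reach: "(i, k) \<in> E \<Longrightarrow> (k, i) \<notin> E\<^sup>*"
  using dag by (meson acyclic_def rtrancl_into_trancl2)

lemma u_at_0: "s i = 0 \<Longrightarrow> u s i = 0"
  by (simp add: u_unfold[of s i])

text \<open>By acyclicity no child of i reaches i, so \<open>s i\<close> enters \<open>u s i\<close>
  only as the leading factor.\<close>

lemma u_scale: "u (s(i := a)) i = a * u (s(i := 1)) i"
  using child_not_reach
  by (simp add: u_unfold[of _ i]) (auto intro!: prod.cong simp: u_cong'[of _ i s a 1])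

lemma u_abs_le_1:
  assumes "\<And>k. \<bar>s k\<bar> \<le> 1"
  shows "\<bar>u s i\<bar> \<le> 1"
proof (induction i rule: children_induct)
  case (children i)
  have "\<bar>1 - A k i + A k i * u s k\<bar> \<le> 1" if "(i, k) \<in> E" for k
  proof -
    have "\<bar>A k i * u s k\<bar> \<le> A k i"
      using children[OF that] coeff_edge[OF that] by (simp add: abs_mult mult_left_le)
    then show ?thesis using coeff_edge[OF that] by linarith
  qed
  then have "(\<Prod>k\<in>E `` {i}. \<bar>1 - A k i + A k i * u s k\<bar>) \<le> 1"
    by (intro prod_le_1) auto
  then show ?case
    unfolding u_unfold[of _ i] abs_mult abs_prod by (intro mult_le_one assms prod_nonneg) auto
qed

lemma u_nonneg_mono:
  assumes "\<And>k. 0 \<le> s k" "\<And>k. s k \<le> s' k"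
  shows "0 \<le> u s i \<and> u s i \<le> u s' i"
proof (induction i rule: children_induct)
  case (children i)
  have "0 \<le> 1 - A k i + A k i * u s k \<and> 1 - A k i + A k i * u s k \<le> 1 - A k i + A k i * u s' k"
    if "(i, k) \<in> E" for k
    using children[OF that] coeff_edge[OF that] by (auto intro!: add_nonneg_nonneg mult_left_mono)
  then have "0 \<le> (\<Prod>k\<in>E `` {i}. 1 - A k i + A k i * u s k)"
    "(\<Prod>k\<in>E `` {i}. 1 - A k i + A k i * u s k) \<le> (\<Prod>k\<in>E `` {i}. 1 - A k i + A k i * u s' k)"
    by (auto intro!: prod_nonneg prod_mono)
  moreover have "0 \<le> s i" "s i \<le> s' i" using assms by blast+
  ultimately show ?case
    unfolding u_unfold[of _ i] by (auto intro!: mult_mono)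
qed

text \<open>Only an edge with coefficient 1 can contribute a zero factor, hence strict positivity of
  s is asked along unit edges only.\<close>

lemma u_pos:
  assumes "\<And>k. 0 \<le> s k" "\<And>k. (i, k) \<in> (unit_edges E A)\<^sup>* \<Longrightarrow> 0 < s k"
  shows "0 < u s i"
  using assms(2)
proof (induction i rule: children_induct)
  case (children i)
  have "0 < 1 - A k i + A k i * u s k" if "(i, k) \<in> E" for k
  proof (cases "A k i = 1")
    case True
    then have "(i, k) \<in> unit_edges E A" using that by (simp add: unit_edges_def)
    with children that have "0 < u s k" by (meson converse_rtrancl_into_rtrancl)
    with True show ?thesis by simp
  next
    case False
    with coeff_edge[OF that] u_nonneg_mono[of s s k, OF assms(1) order_refl] show ?thesis
      by (auto intro!: add_pos_nonneg)
  qed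
  then show ?case
    unfolding u_unfold[of _ i] using children.prems[OF rtrancl.rtrancl_refl]
    by (intro mult_pos_pos prod_pos) auto
qed

lemma u_eq_1:
  assumes "\<And>k. (i, k) \<in> E\<^sup>* \<Longrightarrow> s k = 1"
  shows "u s i = 1"
  using assms
proof (induction i rule: children_induct)
  case (children i)
  have "u s k = 1" if "(i, k) \<in> E" for k
    using children that by (meson converse_rtrancl_into_rtrancl)
  then show ?case using children.prems[of i] by (simp add: u_unfold[of _ i])
qed

lemma u_unit_path_0:
  assumes "(k, l) \<in> (unit_edges E A)\<^sup>*" "s l = 0"
  shows "u s k = 0"
  using assms
proof (induction rule: converse_rtrancl_induct)
  case base
  then show ?case by (simp add: u_at_0)
next
  case (step j k)
  then have "k \<in> E `` {j}" "A k j = 1" by (auto simp: unit_edges_def)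
  with step have "(\<Prod>k\<in>E `` {j}. 1 - A k j + A k j * u s k) = 0"
    by (intro prod_zero) (auto intro!: bexI[of _ k])
  then show ?case by (simp add: u_unfold[of _ j])
qed

text \<open>\<open>s k\<close> influences the other nodes only through \<open>u s k\<close>, which
  is 0 before and after the change.\<close>

lemma u_upd_0:
  assumes "u s k = 0"
  shows "u (s(k := 0)) j = u s j"
proof (induction j rule: children_induct)
  case (children j)
  show ?case
  proof (cases "j = k")
    case True
    then show ?thesis using assms by (simp add: u_at_0)
  next
    case False
    then show ?thesis unfolding u_unfold[of _ j] by (auto intro!: prod.cong simp: children)
  qed
qed

text \<open>Each step of the recursion multiplies polynomials. This supplies the polynomial whose
  degree is compared in the Poisson argument.\<close>

lemma u_poly: "\<exists>P. \<forall>a. u (s(i := a)) j = poly P a"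
proof (induction j rule: children_induct)
  case (children j)
  then have "\<forall>k. \<exists>P. (j, k) \<in> E \<longrightarrow> (\<forall>a. u (s(i := a)) k = poly P a)" by blast
  then obtain P where P: "(j, k) \<in> E \<Longrightarrow> u (s(i := a)) k = poly (P k) a" for k a by metis
  define Q where "Q = (if j = i then [:0, 1:] else [:s j:])"
  have "u (s(i := a)) j = poly (Q * (\<Prod>k\<in>E `` {j}. [:1 - A k j:] + smult (A k j) (P k))) a" for a
    unfolding u_unfold[of _ j] by (auto simp: Q_def poly_prod P intro!: prod.cong)
  then show ?case by blast
qed

lemma pgf_u_pos:
  assumes "i \<in> V" "\<And>k. 0 \<le> s k" "\<And>k. s k \<le> 1"
  shows "0 < pgf (p i) (u s i)"
proof (rule pgf_pos[OF mass[OF assms(1)]])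
  show "0 \<le> u s i" using u_nonneg_mono[of s s i] assms(2) by blast
  have "\<bar>u s i\<bar> \<le> 1" by (rule u_abs_le_1) (use assms(2,3) in \<open>simp add: abs_le_iff order_trans[of _ 0]\<close>)
  then show "u s i \<le> 1" by simp
qed

lemma ex_sink:
  assumes "V \<noteq> {}"
  obtains i where "i \<in> V" "\<not> nonsink E i"
proof -
  obtain i where i: "i \<in> V" "\<And>k. (k, i) \<in> E\<inverse> \<Longrightarrow> k \<notin> V"
    using assms wfE_min'[OF wf_children, of V] by blast
  have "\<not> nonsink E i" using i(2) edges by (auto simp: nonsink_def)
  with i(1) show ?thesis by (rule that)
qed

text \<open>In probabilistic terms, X_l = 0 does not force X_k = 0 when k does not reach l: all
  descendants of k carry 1, so the argument at k is 1, and setting \<open>s k\<close> to 0 lowers it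
  to 0.\<close>

lemma joint_pgf_strict_mono:
  assumes "l \<in> V" "k \<in> V" "(k, l) \<notin> E\<^sup>*"
  shows "joint_pgf V E A p ((\<lambda>_. 1)(l := 0, k := 0)) < joint_pgf V E A p ((\<lambda>_. 1)(l := 0))"
proof -
  let ?a = "(\<lambda>_. 1::real)(l := 0, k := 0)" and ?b = "(\<lambda>_. 1::real)(l := 0)"
  have le: "pgf (p j) (u ?a j) \<le> pgf (p j) (u ?b j)" and pos: "0 < pgf (p j) (u ?a j)" if "j \<in> V" for j
  proof -
    have "0 \<le> u ?a j \<and> u ?a j \<le> u ?b j" by (rule u_nonneg_mono) auto
    moreover have "\<bar>u ?b j\<bar> \<le> 1" by (rule u_abs_le_1) auto
    ultimately show "pgf (p j) (u ?a j) \<le> pgf (p j) (u ?b j)" by (intro pgf_mono mass that) auto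
    show "0 < pgf (p j) (u ?a j)" by (rule pgf_u_pos[OF that]) auto
  qed
  have k: "u ?b k = 1" by (rule u_eq_1) (use assms in auto)
  have "pgf (p k) (u ?a k) < pgf (p k) (u ?b k)"
    unfolding k using u_at_0[of ?a k] by (intro pgf_strict_mono mass assms) auto
  then show ?thesis unfolding joint_pgf_def
    using le pos by (intro prod_mono_strict[of k]) (auto simp: assms finite_V intro: less_imp_le less_le_trans)
qed

end

lemma pgf_arg_coeff_cong:
  assumes "\<And>j k. (j, k) \<in> E \<Longrightarrow> A k j = C k j"
  shows "pgf_arg E A s = pgf_arg E C s"
proof -
  have "(\<lambda>u i. s i * (\<Prod>k\<in>E `` {i}. 1 - A k i + A k i * u k)) = (\<lambda>u i. s i * (\<Prod>k\<in>E `` {i}. 1 - C k i + C k i * u k))"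
    by (intro ext) (auto intro!: prod.cong simp: assms)
  then show ?thesis unfolding pgf_arg_def by simp
qed

section \<open>Removal of a sink\<close>

context thinning_dag
begin

lemma joint_pgf_pos:
  assumes "\<And>k. 0 \<le> s k" "\<And>k. s k \<le> 1"
  shows "0 < joint_pgf V E A p s"
  unfolding joint_pgf_def by (intro prod_pos pgf_u_pos assms)

lemma remove_sink:
  assumes "\<not> nonsink E i"
  shows "thinning_dag (V - {i}) (E - UNIV \<times> {i}) A p"
proof
  show "acyclic (E - UNIV \<times> {i})" using dag acyclic_subset Diff_subset by metis
  show "E - UNIV \<times> {i} \<subseteq> (V - {i}) \<times> (V - {i})" using edges assms by (auto simp: nonsink_def)
qed (use finite_V coeff_edge coeff_nonedge mass in auto)

text \<open>At a sink \<open>u s i = s i\<close>, so its factor in the product of each parent j can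
  be absorbed into the argument at j. For nonparents that factor is 1 because
  \<open>A i j = 0\<close>.\<close>

lemma u_remove_sink:
  assumes i: "i \<in> V" "\<not> nonsink E i" and "j \<in> V" "j \<noteq> i"
  shows "pgf_arg (E - UNIV \<times> {i}) A (\<lambda>j. s j * (1 - A i j + A i j * s i)) j = u s j"
  using assms(3,4)
proof (induction j rule: children_induct)
  case (children j)
  interpret R: thinning_dag "V - {i}" "E - UNIV \<times> {i}" A p using i(2) by (rule remove_sink)
  let ?s = "\<lambda>j. s j * (1 - A i j + A i j * s i)"
  have ui: "u s i = s i" using i(2) by (subst u_unfold) (auto simp: nonsink_def Image_def)
  have IH: "R.u ?s k = u s k" if "(j, k) \<in> E" "k \<noteq> i" for k
    using children.IH[OF that(1)] that edges by auto
  have "R.u ?s j = s j * ((1 - A i j + A i j * s i) * (\<Prod>k\<in>E `` {j} - {i}. 1 - A k j + A k j * u s k))"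
    by (subst R.u_unfold) (auto simp: IH intro!: prod.cong)
  also have "(1 - A i j + A i j * s i) * (\<Prod>k\<in>E `` {j} - {i}. 1 - A k j + A k j * u s k)
      = (\<Prod>k\<in>E `` {j}. 1 - A k j + A k j * u s k)"
  proof (cases "(j, i) \<in> E")
    case True
    then show ?thesis by (subst (2) prod.remove[of _ i]) (auto simp: ui)
  next
    case False
    then have "A i j = 0" using coeff_nonedge i(1) children.prems by blast
    moreover have "E `` {j} - {i} = E `` {j}" using False by auto
    ultimately show ?thesis by simp
  qed
  finally show ?case by (simp add: u_unfold[of s j])
qed

lemma joint_pgf_remove_sink:
  assumes i: "i \<in> V" "\<not> nonsink E i"
  shows "joint_pgf V E A p s =
    pgf (p i) (s i) * joint_pgf (V - {i}) (E - UNIV \<times> {i}) A p (\<lambda>j. s j * (1 - A i j + A i j * s i))"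
proof -
  have ui: "u s i = s i" using i(2) by (subst u_unfold) (auto simp: nonsink_def Image_def)
  show ?thesis unfolding joint_pgf_def
    by (subst prod.remove[OF finite_V i(1)]) (simp add: ui u_remove_sink[OF i])
qed

end

section \<open>Identifiability from the joint generating function\<close>

text \<open>Negative arguments are included because derivatives in an argument are taken at
  0.\<close>

locale thinning_dag_pair = M1: thinning_dag V E A p + M2: thinning_dag V F C q
  for V E A p F C q +
  assumes joint_pgf_eq: "(\<And>k. \<bar>s k\<bar> \<le> 1) \<Longrightarrow> joint_pgf V E A p s = joint_pgf V F C q s"
begin

text \<open>A unit path from k to l gives X_k \<le> X_l in the second model, so X_l = 0 forces X_k =
  0 there. By \<open>joint_pgf_strict_mono\<close> the common generating function rules this out
  unless k also reaches l in E.\<close>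

lemma unit_path_reach:
  assumes "(k, l) \<in> (unit_edges F C)\<^sup>*" "k \<in> V"
  shows "(k, l) \<in> E\<^sup>*"
proof (rule ccontr)
  assume kl: "(k, l) \<notin> E\<^sup>*"
  have "l \<in> V"
    using assms M2.edges by (induction rule: rtrancl_induct) (auto simp: unit_edges_def)
  with M1.joint_pgf_strict_mono[OF _ assms(2) kl]
  have "joint_pgf V E A p ((\<lambda>_. 1)(l := 0, k := 0)) < joint_pgf V E A p ((\<lambda>_. 1)(l := 0))" .
  moreover have "M2.u ((\<lambda>_. 1)(l := 0)) k = 0" by (rule M2.u_unit_path_0[OF assms(1)]) simp
  then have "joint_pgf V F C q ((\<lambda>_. 1)(l := 0, k := 0)) = joint_pgf V F C q ((\<lambda>_. 1)(l := 0))"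
    unfolding joint_pgf_def by (simp add: M2.u_upd_0)
  ultimately show False
    using joint_pgf_eq[of "(\<lambda>_. 1)(l := 0, k := 0)"] joint_pgf_eq[of "(\<lambda>_. 1)(l := 0)"] by simp
qed

text \<open>Choosing \<open>s = 1\<close> on the nodes that a unit-coefficient path joins to a child \<open>k\<close> of \<open>i\<close>, and
  \<open>s = 0\<close> on the remaining nodes, removes the ancestors of \<open>i\<close> and \<open>k\<close> without
  annihilating the dependence on \<open>s i\<close> and \<open>s k\<close>.\<close>
lemma sink_transfer:
  assumes i: "i \<in> V" "\<not> nonsink E i" and ns: "nonsink F i"
  shows "poisson_mass (q i)"
proof -
  obtain k where ik: "(i, k) \<in> F" using ns by (auto simp: nonsink_def)
  then have kV: "k \<in> V" and nki: "(k, i) \<notin> F\<^sup>*" using M2.edges M2.child_not_reach by auto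
  then have neq: "i \<noteq> k" by auto
  define U where "U = {l. (k, l) \<in> (unit_edges F C)\<^sup>*}"
  define \<sigma>0 :: "nat \<Rightarrow> real" where "\<sigma>0 l = (if l \<in> U then 1 else 0)" for l
  define \<sigma> where "\<sigma> a t = \<sigma>0(i := a, k := t)" for a t
  have \<sigma>': "\<sigma> a t = \<sigma>0(k := t, i := a)" for a t using neq by (simp add: \<sigma>_def fun_upd_twist)
  have UF: "(k, l) \<in> F\<^sup>*" if "l \<in> U" for l
    using that rtrancl_mono[of "unit_edges F C" F] by (auto simp: U_def unit_edges_def)
  have iU: "i \<notin> U" using UF nki by blast
  have kU: "k \<in> U" by (simp add: U_def)
  \<comment> \<open>\<open>unit_path_reach\<close> turns the unit path from k to l into a path of E,
    so acyclicity of E excludes the way back.\<close>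
  have U1: "(l, k) \<notin> E\<^sup>*" if "l \<in> U" "l \<noteq> k" for l
    using unit_path_reach[OF _ kV, of l] M1.not_reach_back[of k l] that by (auto simp: U_def)
  have U2: "(l, k) \<notin> F\<^sup>*" if "l \<in> U" "l \<noteq> k" for l
    using UF[OF that(1)] M2.not_reach_back[of k l] that by auto
  have U3: "(l, i) \<notin> F\<^sup>*" if "l \<in> U" for l
    using UF[OF that] nki by (meson rtrancl_trans)
  have sink: "(i, l) \<in> E\<^sup>* \<Longrightarrow> l = i" for l
    using i(2) by (auto simp: nonsink_def elim: converse_rtranclE)
  have out: "\<sigma> a t l = 0" if "l \<notin> U" "l \<noteq> i" for a t l
    using that kU by (auto simp: \<sigma>_def \<sigma>0_def)
  have \<sigma>01: "0 \<le> \<sigma> a t l \<and> \<sigma> a t l \<le> 1" if "0 \<le> a" "a \<le> 1" "0 \<le> t" "t \<le> 1" for a t l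
    using that by (auto simp: \<sigma>_def \<sigma>0_def)
  obtain P where P: "\<And>a. M1.u (\<sigma> a 1) k = poly P a"
    using M1.u_poly[of "\<sigma>0(k := 1)" i k] unfolding \<sigma>' by blast
  \<comment> \<open>In the first model t affects the argument at k alone: the other nodes of U do
    not reach k, the sink i reaches only itself, and all remaining nodes have argument 0.\<close>
  have E1: "M1.u (\<sigma> a t) j = M1.u (\<sigma> a 0) j" if "j \<noteq> k" for a t j
  proof (cases "j \<in> U \<or> j = i")
    case True
    then have "(j, k) \<notin> E\<^sup>*" using U1 that sink neq by auto
    then show ?thesis unfolding \<sigma>_def by (rule M1.u_cong')
  next
    case False
    then show ?thesis using out by (simp add: M1.u_at_0)
  qed
  have E2: "M1.u (\<sigma> a t) k = t * poly P a" for a t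
    using M1.u_scale[of "\<sigma>0(i := a)" k t] P[of a] by (simp add: \<sigma>_def)
  define \<rho> where "\<rho> a = (\<Prod>j\<in>V - {k}. pgf (p j) (M1.u (\<sigma> a 0) j))" for a
  have J1: "joint_pgf V E A p (\<sigma> a t) = \<rho> a * pgf (p k) (t * poly P a)" for a t
  proof -
    have "(\<Prod>j\<in>V - {k}. pgf (p j) (M1.u (\<sigma> a t) j)) = \<rho> a"
      unfolding \<rho>_def by (intro prod.cong arg_cong[of _ _ "pgf _"] E1) auto
    then show ?thesis
      unfolding joint_pgf_def by (simp add: prod.remove[OF M1.finite_V kV] E2 mult.commute)
  qed
  define c where "c = M2.u (\<sigma> 0 1) k"
  have F1: "M2.u (\<sigma> a t) k = t * c" for a t
    using M2.u_scale[of "\<sigma>0(i := a)" k t] M2.u_cong'[OF nki, of "\<sigma>0(k := 1)" a 0]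
    by (simp add: c_def \<sigma>_def fun_upd_twist[OF neq])
  have F2: "M2.u (\<sigma> a t) j = M2.u (\<sigma> 0 0) j" if "j \<noteq> k" "j \<noteq> i" for a t j
  proof (cases "j \<in> U")
    case True
    have "M2.u (\<sigma> a t) j = M2.u (\<sigma> a 0) j" unfolding \<sigma>_def by (rule M2.u_cong'[OF U2[OF True that(1)]])
    also have "\<dots> = M2.u (\<sigma> 0 0) j" unfolding \<sigma>' by (rule M2.u_cong'[OF U3[OF True]])
    finally show ?thesis .
  next
    case False
    then show ?thesis using out that by (simp add: M2.u_at_0)
  qed
  \<comment> \<open>\<open>K\<close> collects the children of i other than k, whose arguments depend
    on neither a nor t. The factor of k is affine in t and splits into the parts w and z t.\<close>
  define K where "K = (\<Prod>l\<in>F `` {i} - {k}. 1 - C l i + C l i * M2.u (\<sigma> 0 0) l)"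
  define w where "w = K * (1 - C k i)"
  define z where "z = K * C k i * c"
  have irr: "l \<noteq> i" if "(i, l) \<in> F" for l using that M2.child_not_reach by auto
  have F3: "M2.u (\<sigma> a t) i = a * (w + z * t)" for a t
  proof -
    have "(\<Prod>l\<in>F `` {i} - {k}. 1 - C l i + C l i * M2.u (\<sigma> a t) l) = K"
      unfolding K_def using irr by (intro prod.cong refl) (metis DiffE F2 ImageE singletonD singletonI)
    then have "(\<Prod>l\<in>F `` {i}. 1 - C l i + C l i * M2.u (\<sigma> a t) l) = (1 - C k i + C k i * (t * c)) * K"
      using ik by (subst prod.remove[of _ k]) (auto simp: F1)
    moreover have "\<sigma> a t i = a" by (simp add: \<sigma>')
    ultimately have "M2.u (\<sigma> a t) i = a * ((1 - C k i + C k i * (t * c)) * K)"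
      using M2.u_unfold[of "\<sigma> a t" i] by simp
    then show ?thesis by (simp add: w_def z_def algebra_simps)
  qed
  \<comment> \<open>An edge from i to l in F with coefficient 1 would be a unit path, so i would
    reach l in E, where i is a sink. This keeps \<open>K\<close> and \<open>w\<close>
    positive.\<close>
  have lt1: "C l i < 1" if "(i, l) \<in> F" for l
  proof (rule ccontr)
    assume "\<not> C l i < 1"
    then have "(i, l) \<in> unit_edges F C" using that M2.coeff_edge[OF that] by (auto simp: unit_edges_def)
    then have "(i, l) \<in> E\<^sup>*" using unit_path_reach i(1) by blast
    then show False using sink irr[OF that] by blast
  qed
  have un: "0 \<le> M2.u (\<sigma> 0 0) l" "M2.u (\<sigma> 0 0) l \<le> 1" for l
    using M2.u_nonneg_mono[of "\<sigma> 0 0" "\<sigma> 0 0" l] M2.u_abs_le_1[of "\<sigma> 0 0" l] \<sigma>01[of 0 0] by (auto simp: abs_le_iff)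
  have K: "0 < K" "K \<le> 1"
  proof -
    have "0 < 1 - C l i + C l i * M2.u (\<sigma> 0 0) l \<and> 1 - C l i + C l i * M2.u (\<sigma> 0 0) l \<le> 1" if "(i, l) \<in> F" for l
    proof -
      have "0 \<le> C l i * M2.u (\<sigma> 0 0) l" "C l i * M2.u (\<sigma> 0 0) l \<le> C l i"
        using M2.coeff_edge[OF that] un[of l] by (auto simp: mult_left_le)
      then show ?thesis using lt1[OF that] by linarith
    qed
    note bounds = this
    show "0 < K" unfolding K_def using bounds by (intro prod_pos) auto
    show "K \<le> 1" unfolding K_def using bounds by (intro prod_le_1) (auto intro: less_imp_le)
  qed
  \<comment> \<open>All nodes reached from k by unit edges lie in U and carry the argument 1 under
    \<open>\<sigma> 0 1\<close>.\<close>
  have c0: "0 < c" unfolding c_def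
  proof (rule M2.u_pos)
    show "0 \<le> \<sigma> 0 1 l" for l using \<sigma>01 by auto
    show "0 < \<sigma> 0 1 l" if "(k, l) \<in> (unit_edges F C)\<^sup>*" for l
      using that iU by (auto simp: \<sigma>_def \<sigma>0_def U_def)
  qed
  define D where "D = (\<Prod>j\<in>V - {k} - {i}. pgf (q j) (M2.u (\<sigma> 0 0) j))"
  have D: "0 < D" unfolding D_def using \<sigma>01[of 0 0] by (intro prod_pos M2.pgf_u_pos) auto
  have J2: "joint_pgf V F C q (\<sigma> a t) = D * pgf (q k) (c * t) * pgf (q i) (a * (w + z * t))" for a t
  proof -
    have "joint_pgf V F C q (\<sigma> a t) = pgf (q k) (M2.u (\<sigma> a t) k) * (pgf (q i) (M2.u (\<sigma> a t) i)
       * (\<Prod>j\<in>V - {k} - {i}. pgf (q j) (M2.u (\<sigma> a t) j)))"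
      unfolding joint_pgf_def using kV i(1) neq M1.finite_V
      by (simp add: prod.remove[of V k] prod.remove[of "V - {k}" i])
    also have "(\<Prod>j\<in>V - {k} - {i}. pgf (q j) (M2.u (\<sigma> a t) j)) = D"
      unfolding D_def by (intro prod.cong refl arg_cong[of _ _ "pgf _"] F2) auto
    finally show ?thesis by (simp add: F1 F3 mult_ac)
  qed
  show ?thesis
  proof (rule poisson_mass_of_polynomial_fibre[OF M1.mass[OF kV] M2.mass[OF kV] M2.mass[OF i(1)]])
    show "0 < w" "0 < z" "0 < D"
      using K c0 D lt1[OF ik] M2.coeff_edge[OF ik] by (auto simp: w_def z_def)
    have "w \<le> 1 - C k i" unfolding w_def using K lt1[OF ik] by (simp add: mult_left_le_one_le)
    then show "w < 1" using M2.coeff_edge[OF ik] by linarith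
    show "\<rho> a * pgf (p k) (t * poly P a) = D * pgf (q k) (c * t) * pgf (q i) (a * (w + z * t))"
      if "0 < a" "a < 1" "\<bar>t\<bar> \<le> 1" for a t
    proof -
      have "\<bar>\<sigma> a t l\<bar> \<le> 1" for l using that by (auto simp: \<sigma>_def \<sigma>0_def)
      then have "joint_pgf V E A p (\<sigma> a t) = joint_pgf V F C q (\<sigma> a t)" by (rule joint_pgf_eq)
      then show ?thesis by (simp only: J1 J2)
    qed
  qed
qed

text \<open>With the rest of the models equal, both generating functions are a factor of i times the
  same function \<open>G\<close> at arguments scaled by row i. Zero arguments off i isolate the law
  of i; the coefficients follow from strict monotonicity, each node j being treated after all its
  proper descendants.\<close>

lemma common_sink_row:
  assumes i: "i \<in> V" "\<not> nonsink E i" "\<not> nonsink F i"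
    and EF: "E - UNIV \<times> {i} = F - UNIV \<times> {i}"
    and AC: "\<And>j k. j \<in> V - {i} \<Longrightarrow> k \<in> V - {i} \<Longrightarrow> A k j = C k j"
    and pq: "\<And>j. j \<in> V - {i} \<Longrightarrow> p j = q j"
  shows "p i = q i" "j \<in> V \<Longrightarrow> A i j = C i j"
proof -
  define E' where "E' = E - UNIV \<times> {i}"
  interpret R: thinning_dag "V - {i}" E' A p
    unfolding E'_def using i(2) by (rule M1.remove_sink)
  define G where "G = joint_pgf (V - {i}) E' A p"
  have G: "joint_pgf (V - {i}) (F - UNIV \<times> {i}) C q s = G s" for s
  proof -
    have "A k j = C k j" if "(j, k) \<in> E'" for j k using that R.edges AC by blast
    from pgf_arg_coeff_cong[of E' A C, OF this] show ?thesis
      unfolding G_def EF[symmetric] E'_def[symmetric] joint_pgf_def by (intro prod.cong) (auto simp: pq)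
  qed
  have key: "pgf (p i) (s i) * G (\<lambda>j. s j * (1 - A i j + A i j * s i))
      = pgf (q i) (s i) * G (\<lambda>j. s j * (1 - C i j + C i j * s i))" if "\<And>k. \<bar>s k\<bar> \<le> 1" for s
    using joint_pgf_eq[OF that] unfolding M1.joint_pgf_remove_sink[OF i(1,2)] M2.joint_pgf_remove_sink[OF i(1,3)] G
    by (simp add: G_def E'_def)
  have diag: "A i i = 0" "C i i = 0"
    using i M1.coeff_nonedge[of i i] M2.coeff_nonedge[of i i] by (auto simp: nonsink_def)
  show pi: "p i = q i"
  proof (rule pgf_inject[OF M1.mass[OF i(1)] M2.mass[OF i(1)]])
    fix t :: real assume t: "0 < t" "t < 1"
    let ?s = "(\<lambda>_. 0)(i := t)"
    have sA: "(\<lambda>j. ?s j * (1 - A i j + A i j * ?s i)) = ?s" and sC: "(\<lambda>j. ?s j * (1 - C i j + C i j * ?s i)) = ?s"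
      by (auto simp: fun_eq_iff diag)
    have "0 < G ?s" unfolding G_def by (rule R.joint_pgf_pos) (use t in auto)
    with key[of ?s] t show "pgf (p i) t = pgf (q i) t" unfolding sA sC by auto
  qed
  have rec: "A i j = C i j"
    if j: "j \<in> V - {i}" and IH: "\<And>k. (j, k) \<in> E'\<^sup>+ \<Longrightarrow> A i k = C i k" for j
  proof -
    \<comment> \<open>The value 1/2 at i keeps each factor \<open>1 - A i l + A i l * s i\<close>
      positive and still dependent on \<open>A i l\<close>. Zeros outside the descendants of j mute
      the nodes whose coefficients need not be known yet.\<close>
    define s :: "nat \<Rightarrow> real" where "s l = (if l = i then 1 / 2 else if (j, l) \<in> E'\<^sup>* then 1 else 0)" for l
    define sA where "sA l = s l * (1 - A i l + A i l * s i)" for l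
    define sC where "sC l = s l * (1 - C i l + C i l * s i)" for l
    have coeff: "0 \<le> A i l \<and> A i l \<le> 1 \<and> 0 \<le> C i l \<and> C i l \<le> 1" if "l \<in> V" for l
      using M1.coeff_edge[of l i] M1.coeff_nonedge[of i l] M2.coeff_edge[of l i] M2.coeff_nonedge[of i l] that i(1)
      by fastforce
    have desc: "l \<in> V - {i}" if "(j, l) \<in> E'\<^sup>*" for l
      using that j R.edges by (induction rule: rtrancl_induct) auto
    \<comment> \<open>By \<open>IH\<close> the two argument vectors can differ only at j.\<close>
    have sAC: "sC = sA(j := sC j)"
    proof
      fix l
      show "sC l = (sA(j := sC j)) l"
        using IH[of l] j desc[of l] diag by (auto simp: sA_def sC_def s_def rtrancl_eq_or_trancl)
    qed
    \<comment> \<open>\<open>m\<close> is the slope of the argument at j in its own variable; since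
      it is positive, \<open>sA j * m = sC j * m\<close> gives \<open>sA j = sC j\<close>.\<close>
    define m where "m = R.u (sA(j := 1)) j"
    have sA0: "0 \<le> sA l \<and> sA l \<le> 1" and sC0: "0 \<le> sC l \<and> sC l \<le> 1" for l
      using coeff[of l] desc[of l] i(1) diag by (auto simp: sA_def sC_def s_def)
    have m: "0 < m" unfolding m_def
    proof (rule R.u_pos)
      show "0 \<le> (sA(j := 1)) k" for k using sA0 by simp
      fix k assume "(j, k) \<in> (unit_edges E' A)\<^sup>*"
      then have "(j, k) \<in> E'\<^sup>*" using rtrancl_mono[of "unit_edges E' A" E'] by (auto simp: unit_edges_def)
      then show "0 < (sA(j := 1)) k" using desc[of k] coeff[of k] by (auto simp: sA_def s_def)
    qed
    have uA: "R.u sA j = sA j * m" and uC: "R.u sC j = sC j * m"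
      using R.u_scale[of sA j "sA j"] R.u_scale[of sA j "sC j"] by (simp_all add: m_def sAC[symmetric])
    have uAC: "R.u sC l = R.u sA l" if "l \<noteq> j" "l \<noteq> i" for l
    proof (cases "(j, l) \<in> E'\<^sup>*")
      case True
      then have "(l, j) \<notin> E'\<^sup>*" using R.not_reach_back that by auto
      from R.u_cong'[OF this, of sA "sC j" "sA j"] show ?thesis by (simp add: sAC[symmetric])
    next
      case False
      then have "sA l = 0" "sC l = 0" using that by (auto simp: sA_def sC_def s_def)
      then show ?thesis by (simp add: R.u_at_0)
    qed
    define Q where "Q = (\<Prod>l\<in>V - {i} - {j}. pgf (p l) (R.u sA l))"
    have GA: "G sA = pgf (p j) (sA j * m) * Q"
      unfolding G_def joint_pgf_def Q_def by (simp add: prod.remove[OF R.finite_V j] uA)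
    have "(\<Prod>l\<in>V - {i} - {j}. pgf (p l) (R.u sC l)) = Q" unfolding Q_def by (intro prod.cong) (auto simp: uAC)
    then have GC: "G sC = pgf (p j) (sC j * m) * Q"
      unfolding G_def joint_pgf_def by (simp add: prod.remove[OF R.finite_V j] uC)
    have Q: "0 < Q" unfolding Q_def using sA0 by (intro prod_pos R.pgf_u_pos) auto
    have "0 < pgf (p i) (1 / 2)" by (intro pgf_pos M1.mass i) auto
    moreover have "\<bar>s k\<bar> \<le> 1" for k by (simp add: s_def)
    ultimately have "G sA = G sC" using key[of s] pi by (simp add: sA_def[abs_def] sC_def[abs_def] s_def)
    then have eq: "pgf (p j) (sA j * m) = pgf (p j) (sC j * m)" using Q by (simp add: GA GC)
    have "\<bar>m\<bar> \<le> 1" unfolding m_def by (rule R.u_abs_le_1) (use sA0 in \<open>auto simp: abs_le_iff intro: order_trans[OF _ zero_le_one]\<close>)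
    then have "0 \<le> sA j * m" "sA j * m \<le> 1" "0 \<le> sC j * m" "sC j * m \<le> 1"
      using m sA0[of j] sC0[of j] by (auto intro!: mult_le_one)
    with eq pgf_strict_mono[OF R.mass[OF j]] have "sA j * m = sC j * m"
      by (metis less_irrefl linorder_cases)
    then have "sA j = sC j" using m by simp
    then show "A i j = C i j" using j by (auto simp: sA_def sC_def s_def)
  qed
  have wf: "wf ((E'\<^sup>+)\<inverse>)" using wf_trancl[OF R.wf_children] by (simp add: trancl_converse)
  have "j \<in> V - {i} \<longrightarrow> A i j = C i j" for j
  proof (induction j rule: wf_induct_rule[OF wf])
    case (1 j)
    show ?case
    proof
      assume j: "j \<in> V - {i}"
      show "A i j = C i j"
      proof (rule rec[OF j])
        fix k assume jk: "(j, k) \<in> E'\<^sup>+"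
        then have "k \<in> V - {i}" using R.edges by (auto elim: tranclE)
        with 1 jk show "A i k = C i k" by simp
      qed
    qed
  qed
  then show "A i j = C i j" if "j \<in> V" using that diag by (cases "j = i") auto
qed

end

text \<open>Induction on the number of nodes: a sink of E is a sink of F by
  \<open>sink_transfer\<close>, where the non-Poisson hypothesis enters. Removing it gives a smaller
  pair, and \<open>common_sink_row\<close> restores its law and row.\<close>

lemma thinning_dag_identifiable:
  assumes "thinning_dag_pair V E A p F C q"
    and "\<And>i. i \<in> V \<Longrightarrow> nonsink F i \<Longrightarrow> \<not> poisson_mass (q i)"
  shows "E = F \<and> (\<forall>i\<in>V. \<forall>j\<in>V. A i j = C i j) \<and> (\<forall>i\<in>V. p i = q i)"
  using assms
proof (induction "card V" arbitrary: V E F)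
  case 0
  interpret thinning_dag_pair V E A p F C q by fact
  show ?case using 0 M1.finite_V M1.edges M2.edges by auto
next
  case (Suc n)
  interpret thinning_dag_pair V E A p F C q by fact
  have "V \<noteq> {}" using Suc by auto
  then obtain i where i: "i \<in> V" "\<not> nonsink E i" using M1.ex_sink by blast
  then have i': "\<not> nonsink F i" using sink_transfer Suc.prems(2) by blast
  define E' where "E' = E - UNIV \<times> {i}"
  define F' where "F' = F - UNIV \<times> {i}"
  interpret R1: thinning_dag "V - {i}" E' A p unfolding E'_def using i(2) by (rule M1.remove_sink)
  interpret R2: thinning_dag "V - {i}" F' C q unfolding F'_def using i' by (rule M2.remove_sink)
  have IH: "E' = F' \<and> (\<forall>j\<in>V - {i}. \<forall>k\<in>V - {i}. A j k = C j k) \<and> (\<forall>j\<in>V - {i}. p j = q j)"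
  proof (rule Suc.hyps(1))
    show "n = card (V - {i})" using Suc.hyps(2) i(1) by simp
    show "thinning_dag_pair (V - {i}) E' A p F' C q"
    proof
      fix s :: "nat \<Rightarrow> real" assume s: "\<And>k. \<bar>s k\<bar> \<le> 1"
      \<comment> \<open>Argument 1 at i marginalises the sink out: its generating function and all
        scaling factors become 1, and the reduced graphs do not see \<open>s i\<close>.\<close>
      have "R1.u (s(i := 1)) j = R1.u s j" if "j \<in> V - {i}" for j
      proof -
        have "(j, i) \<notin> E'\<^sup>*" using that by (auto simp: E'_def elim: rtranclE)
        from R1.u_cong'[OF this, of s 1 "s i"] show ?thesis by simp
      qed
      then have 1: "joint_pgf (V - {i}) E' A p (s(i := 1)) = joint_pgf (V - {i}) E' A p s"
        unfolding joint_pgf_def by simp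
      have "R2.u (s(i := 1)) j = R2.u s j" if "j \<in> V - {i}" for j
      proof -
        have "(j, i) \<notin> F'\<^sup>*" using that by (auto simp: F'_def elim: rtranclE)
        from R2.u_cong'[OF this, of s 1 "s i"] show ?thesis by simp
      qed
      then have 2: "joint_pgf (V - {i}) F' C q (s(i := 1)) = joint_pgf (V - {i}) F' C q s"
        unfolding joint_pgf_def by simp
      have "joint_pgf V E A p (s(i := 1)) = joint_pgf V F C q (s(i := 1))"
        using s by (intro joint_pgf_eq) auto
      then show "joint_pgf (V - {i}) E' A p s = joint_pgf (V - {i}) F' C q s"
        unfolding M1.joint_pgf_remove_sink[OF i] M2.joint_pgf_remove_sink[OF i(1) i']
        using 1 2 pgf_1[OF M1.mass[OF i(1)]] pgf_1[OF M2.mass[OF i(1)]]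
        by (simp add: E'_def F'_def fun_upd_def cong: if_cong)
    qed
    show "\<not> poisson_mass (q j)" if "j \<in> V - {i}" "nonsink F' j" for j
      using Suc.prems(2)[of j] that by (auto simp: nonsink_def F'_def)
  qed
  have pi: "p i = q i" and Ai: "\<And>j. j \<in> V \<Longrightarrow> A i j = C i j"
    using common_sink_row[OF i i'] IH unfolding E'_def F'_def by blast+
  \<comment> \<open>Edges into i are exactly the positive entries of row i.\<close>
  have "(j, i) \<in> E \<longleftrightarrow> (j, i) \<in> F" for j
    using Ai[of j] M1.edges M2.edges M1.coeff_edge[of j i] M2.coeff_edge[of j i]
      M1.coeff_nonedge[of i j] M2.coeff_nonedge[of i j] i(1) by fastforce
  moreover have "E' = F'" using IH by blast
  ultimately have "E = F" unfolding E'_def F'_def by fast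
  moreover have "A k i = C k i" if "k \<in> V" for k
    using M1.coeff_nonedge[of k i] M2.coeff_nonedge[of k i] i i' that by (auto simp: nonsink_def)
  ultimately show ?case using IH pi Ai by blast
qed

section \<open>Thinning models and their joint generating functions\<close>

lemma measurable_nat_add:
  fixes f g :: "'c \<Rightarrow> nat"
  assumes "f \<in> measurable M (count_space UNIV)" "g \<in> measurable M (count_space UNIV)"
  shows "(\<lambda>x. f x + g x) \<in> measurable M (count_space UNIV)"
  by (rule measurable_compose_countable[OF _ assms(1), where f="\<lambda>i x. i + g x"])
    (rule measurable_compose[OF assms(2)], simp)

lemma measurable_nat_sum:
  fixes f :: "'i \<Rightarrow> 'c \<Rightarrow> nat"
  assumes "\<And>i. i \<in> I \<Longrightarrow> f i \<in> measurable M (count_space UNIV)"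
  shows "(\<lambda>x. \<Sum>i\<in>I. f i x) \<in> measurable M (count_space UNIV)"
  using assms by (induction I rule: infinite_finite_induct) (auto intro: measurable_nat_add)

lemma law_eqI:
  assumes "prob_space M" "prob_space N" "Y \<in> measurable M (count_space UNIV)" "sets N = UNIV"
    and "\<And>n. measure M {\<omega> \<in> space M. Y \<omega> = n} = measure N {n}"
  shows "law M Y = N"
proof (rule measure_eqI_countable[of _ UNIV])
  interpret M: prob_space M by fact
  interpret N: prob_space N by fact
  show "sets (law M Y) = Pow UNIV" by (simp add: law_def)
  show "sets N = Pow UNIV" using assms(4) by simp
  show "emeasure (law M Y) {n} = emeasure N {n}" for n
    using assms(5)[of n]
    by (simp add: law_def emeasure_distr[OF assms(3)] M.emeasure_eq_measure N.emeasure_eq_measure vimage_def Int_def conj_commute)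
qed simp

section \<open>Mass functions of count-valued random variables\<close>

context prob_space
begin

definition count_mass :: "('a \<Rightarrow> nat) \<Rightarrow> nat \<Rightarrow> real" where
  "count_mass Y n = prob {\<omega> \<in> space M. Y \<omega> = n}"

lemma count_mass_nonneg: "0 \<le> count_mass Y n"
  by (simp add: count_mass_def)

lemma count_mass_sums_1:
  assumes "random_variable (count_space UNIV) Y"
  shows "count_mass Y sums 1"
proof -
  have "(\<lambda>n. prob {\<omega> \<in> space M. Y \<omega> = n}) sums prob (\<Union>n. {\<omega> \<in> space M. Y \<omega> = n})"
    using assms by (intro finite_measure_UNION) (auto simp: disjoint_family_on_def)
  moreover have "(\<Union>n. {\<omega> \<in> space M. Y \<omega> = n}) = space M" by auto
  ultimately show ?thesis by (simp add: count_mass_def[abs_def] prob_space)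
qed

text \<open>Expand \<open>x ^ Y \<omega>\<close> over the events Y = n and interchange sum and
  expectation, which absolute summability permits.\<close>

lemma pgf_count_mass:
  assumes Y: "random_variable (count_space UNIV) Y" and x: "\<bar>x\<bar> \<le> 1"
  shows "pgf (count_mass Y) x = expectation (\<lambda>\<omega>. x ^ Y \<omega>)"
    "summable (\<lambda>n. \<bar>count_mass Y n * x ^ n\<bar>)"
proof -
  define f where "f n \<omega> = indicator {\<omega> \<in> space M. Y \<omega> = n} \<omega> * x ^ n" for n \<omega>
  have [measurable]: "{\<omega> \<in> space M. Y \<omega> = n} \<in> events" for n using Y by simp
  have int: "integrable M (f n)" for n by (simp add: f_def[abs_def] emeasure_eq_measure)
  have I: "expectation (f n) = count_mass Y n * x ^ n" for n by (simp add: f_def[abs_def] count_mass_def)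
  have N: "expectation (\<lambda>\<omega>. norm (f n \<omega>)) = \<bar>count_mass Y n * x ^ n\<bar>" for n
    by (simp add: f_def count_mass_def abs_mult)
  show s: "summable (\<lambda>n. \<bar>count_mass Y n * x ^ n\<bar>)"
  proof (rule summable_comparison_test)
    show "summable (count_mass Y)" using count_mass_sums_1[OF Y] by (simp add: sums_iff)
    show "\<exists>N. \<forall>n\<ge>N. norm \<bar>count_mass Y n * x ^ n\<bar> \<le> count_mass Y n"
      using x count_mass_nonneg by (auto simp: abs_mult power_abs intro!: mult_left_le power_le_one)
  qed
  have fs: "(\<lambda>n. f n \<omega>) sums (x ^ Y \<omega>)" if "\<omega> \<in> space M" for \<omega>
  proof -
    have "(\<lambda>n. if n = Y \<omega> then x ^ n else 0) sums (x ^ Y \<omega>)" by (rule sums_single)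
    moreover have "(\<lambda>n. if n = Y \<omega> then x ^ n else 0) = (\<lambda>n. f n \<omega>)"
      using that by (auto simp: f_def fun_eq_iff)
    ultimately show ?thesis by simp
  qed
  have fn: "summable (\<lambda>n. norm (f n \<omega>))" if "\<omega> \<in> space M" for \<omega>
    by (rule summable_finite[of "{Y \<omega>}"]) (auto simp: f_def)
  have "(\<lambda>n. expectation (f n)) sums expectation (\<lambda>\<omega>. \<Sum>n. f n \<omega>)"
    by (rule sums_integral[OF int]) (use fn s N in auto)
  also have "expectation (\<lambda>\<omega>. \<Sum>n. f n \<omega>) = expectation (\<lambda>\<omega>. x ^ Y \<omega>)"
    by (rule Bochner_Integration.integral_cong) (use fs in \<open>auto simp: sums_iff\<close>)
  finally show "pgf (count_mass Y) x = expectation (\<lambda>\<omega>. x ^ Y \<omega>)"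
    by (simp add: I pgf_def sums_iff)
qed

lemma pgf_count_mass_has_sum:
  assumes Y: "random_variable (count_space UNIV) Y" and x: "\<bar>x\<bar> \<le> 1"
  shows "((\<lambda>n. count_mass Y n * x ^ n) has_sum pgf (count_mass Y) x) UNIV"
  using pgf_count_mass(2)[OF assms] unfolding pgf_def
  by (intro norm_summable_imp_has_sum) (auto intro: summable_sums summable_rabs_cancel)

lemma expectation_power_bernoulli:
  assumes Y: "random_variable (count_space UNIV) Y" and "bernoulli_distributed M a Y" "0 \<le> a" "a \<le> 1"
  shows "expectation (\<lambda>\<omega>. x ^ Y \<omega>) = 1 - a + a * (x::real)"
proof -
  have "expectation (\<lambda>\<omega>. x ^ Y \<omega>) = integral\<^sup>L (law M Y) (\<lambda>n. x ^ n)"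
    unfolding law_def by (rule integral_distr[symmetric]) (use Y in auto)
  also have "\<dots> = measure_pmf.expectation (bernoulli_pmf a) (\<lambda>b. x ^ of_bool b)"
    using assms(2) by (simp add: bernoulli_distributed_def)
  also have "\<dots> = 1 - a + a * x" using assms(3,4) by simp
  finally show ?thesis .
qed

text \<open>If all mass sat at 0, Y would be almost surely 0 and its variance 0.\<close>

lemma nondeg_mass_count_mass:
  assumes Y: "random_variable (count_space UNIV) Y"
    and 0: "0 < prob {\<omega> \<in> space M. Y \<omega> = 0}" and v: "0 < variance (\<lambda>\<omega>. real (Y \<omega>))"
  shows "nondeg_mass (count_mass Y)"
proof -
  have "\<exists>n>0. 0 < count_mass Y n"
  proof (rule ccontr)
    assume "\<not> (\<exists>n>0. 0 < count_mass Y n)"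
    then have z: "count_mass Y n = 0" if "n > 0" for n
      using that count_mass_nonneg[of Y n] by (meson antisym_conv1 not_less)
    have "count_mass Y sums count_mass Y 0"
      using sums_finite[of "{0}" "count_mass Y"] z by auto
    then have "prob {\<omega> \<in> space M. Y \<omega> = 0} = 1"
      using count_mass_sums_1[OF Y] sums_unique2 by (metis count_mass_def)
    then have ae: "AE \<omega> in M. Y \<omega> = 0"
      using Y by (subst (asm) prob_Collect_eq_1) auto
    have [measurable]: "(\<lambda>\<omega>. real (Y \<omega>)) \<in> borel_measurable M"
      using measurable_compose[OF Y, of real borel] by simp
    have e: "expectation (\<lambda>\<omega>. real (Y \<omega>)) = 0"
      by (rule integral_eq_zero_AE) (use ae in auto)
    have "variance (\<lambda>\<omega>. real (Y \<omega>)) = 0"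
      unfolding e by (rule integral_eq_zero_AE) (use ae in auto)
    with v show False by simp
  qed
  then show ?thesis
    using 0 count_mass_sums_1[OF Y] count_mass_nonneg by (auto simp: nondeg_mass_def count_mass_def)
qed

end

section \<open>Factorisation of state probabilities and summation over states\<close>

context binomial_thinning_sem
begin

definition noise :: "nat + nat \<times> nat \<times> nat \<Rightarrow> 'a \<Rightarrow> nat" where
  "noise k = (case k of Inl i \<Rightarrow> \<epsilon> i | Inr (i, j, l) \<Rightarrow> B i j l)"

text \<open>The noise entering the equation of node i. Distinct rows are disjoint blocks of the
  independent family.\<close>

definition row :: "nat \<Rightarrow> (nat + nat \<times> nat \<times> nat) set" where
  "row i = insert (Inl i) (Inr ` {(i', j, l). i' = i \<and> (j, i) \<in> E \<and> 1 \<le> l})"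

text \<open>The right side of the structural equation with the parent values frozen at a
  deterministic state x; it depends on the noise of row i only.\<close>

definition row_sum :: "nat \<Rightarrow> (nat \<Rightarrow> nat) \<Rightarrow> 'a \<Rightarrow> nat" where
  "row_sum i x \<omega> = \<epsilon> i \<omega> + (\<Sum>j\<in>pa E i. \<Sum>l = 1..x j. B i j l \<omega>)"

lemma finite_pa [simp]: "finite (pa E i)"
  by (rule finite_subset[of _ "{1..d}"]) (use edges in \<open>auto simp: pa_def\<close>)

lemma pa_subset: "pa E i \<subseteq> {1..d}"
  using edges by (auto simp: pa_def)

lemma row_subset:
  assumes "i \<in> {1..d}"
  shows "row i \<subseteq> {1..d} <+> {(i, j, l). (j, i) \<in> E \<and> 1 \<le> l}"
  using assms by (auto simp: row_def)

lemma indep_noise: "indep_vars (\<lambda>_. count_space UNIV) noise ({1..d} <+> {(i, j, l). (j, i) \<in> E \<and> 1 \<le> l})"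
  using noise_indep unfolding noise_def[abs_def] .

lemma measurable_noise:
  "k \<in> {1..d} <+> {(i, j, l). (j, i) \<in> E \<and> 1 \<le> l} \<Longrightarrow> random_variable (count_space UNIV) (noise k)"
  using indep_noise by (auto simp: indep_vars_def)

lemma measurable_exogenous: "i \<in> {1..d} \<Longrightarrow> random_variable (count_space UNIV) (\<epsilon> i)"
  using measurable_noise[OF InlI, of i] by (simp only: noise_def sum.case)

lemma measurable_offspring: "(j, i) \<in> E \<Longrightarrow> 1 \<le> l \<Longrightarrow> random_variable (count_space UNIV) (B i j l)"
  using measurable_noise[of "Inr (i, j, l)"] by (auto simp: noise_def)

lemma measurable_row_sum: "i \<in> {1..d} \<Longrightarrow> random_variable (count_space UNIV) (row_sum i x)"
  unfolding row_sum_def[abs_def]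
  by (intro measurable_nat_add measurable_nat_sum measurable_exogenous measurable_offspring) (auto simp: pa_def)

lemma thinning_dag_restrict:
  assumes "W \<subseteq> {1..d}"
  shows "thinning_dag W (E \<inter> W \<times> W) A (\<lambda>i. count_mass (\<epsilon> i))"
proof
  show "finite W" using assms finite_subset by blast
  show "acyclic (E \<inter> W \<times> W)" using dag acyclic_subset by (metis Int_lower1)
  show "A i j = 0" if "i \<in> W" "j \<in> W" "(j, i) \<notin> E \<inter> W \<times> W" for i j
    using that assms by (intro coeff_nonedge) (auto simp: pa_def)
  show "nondeg_mass (count_mass (\<epsilon> i))" if "i \<in> W" for i
    using that assms by (intro nondeg_mass_count_mass measurable_exogenous A1 A2) auto
qed (use coeff_edge in auto)

text \<open>At a frozen state the row sum adds independent variables: the exogenous one and, for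
  each parent j, \<open>x j\<close> Bernoulli variables with generating function
  \<open>1 - A i j + A i j * s\<close>.\<close>

lemma pgf_row_sum:
  assumes i: "i \<in> {1..d}" and s: "\<bar>s\<bar> \<le> 1"
  shows "pgf (count_mass (row_sum i x)) s =
    pgf (count_mass (\<epsilon> i)) s * (\<Prod>j\<in>pa E i. (1 - A i j + A i j * s) ^ x j)"
proof -
  \<comment> \<open>Only finitely many offspring variables occur at the state x; \<open>L\<close>
    below is this finite part of the row.\<close>
  define K where "K = Sigma (pa E i) (\<lambda>j. {1..x j})"
  define h where "h = (\<lambda>(j, l). Inr (i, j, l) :: nat + nat \<times> nat \<times> nat)"
  have K: "finite K" by (simp add: K_def)
  have h: "inj_on h K" by (auto simp: h_def inj_on_def)
  define L where "L = insert (Inl i) (h ` K)"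
  have sub: "L \<subseteq> row i" by (auto simp: L_def h_def K_def row_def pa_def)
  have "indep_vars (\<lambda>_. count_space UNIV) noise L"
    using indep_noise sub row_subset[OF i] by (meson indep_vars_subset subset_trans)
  then have ind: "indep_vars (\<lambda>_. borel) (\<lambda>k \<omega>. s ^ noise k \<omega>) L"
    by (rule indep_vars_compose2) simp
  have int: "integrable M (\<lambda>\<omega>. s ^ noise k \<omega>)" if "k \<in> L" for k
  proof (rule integrable_const_bound[of _ 1])
    show "(\<lambda>\<omega>. s ^ noise k \<omega>) \<in> borel_measurable M" using ind that by (auto simp: indep_vars_def)
    show "AE \<omega> in M. norm (s ^ noise k \<omega>) \<le> 1" using s by (auto simp: power_abs power_le_one)
  qed
  have prodL: "(\<Prod>k\<in>L. f k) = f (Inl i) * (\<Prod>j\<in>pa E i. \<Prod>l = 1..x j. f (Inr (i, j, l)))" for f :: "_ \<Rightarrow> real"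
  proof -
    have "(\<Prod>k\<in>L. f k) = f (Inl i) * (\<Prod>k\<in>h ` K. f k)"
      unfolding L_def using K by (subst prod.insert) (auto simp: h_def)
    also have "(\<Prod>k\<in>h ` K. f k) = (\<Prod>(j, l)\<in>K. f (Inr (i, j, l)))"
      using h by (subst prod.reindex) (auto simp: h_def intro!: prod.cong)
    also have "\<dots> = (\<Prod>j\<in>pa E i. \<Prod>l = 1..x j. f (Inr (i, j, l)))"
      unfolding K_def by (subst prod.Sigma) auto
    finally show ?thesis .
  qed
  have "pgf (count_mass (row_sum i x)) s = expectation (\<lambda>\<omega>. s ^ row_sum i x \<omega>)"
    using measurable_row_sum[OF i] s by (rule pgf_count_mass)
  also have "\<dots> = expectation (\<lambda>\<omega>. \<Prod>k\<in>L. s ^ noise k \<omega>)"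
    unfolding prodL by (simp add: row_sum_def noise_def power_add power_sum)
  also have "\<dots> = (\<Prod>k\<in>L. expectation (\<lambda>\<omega>. s ^ noise k \<omega>))"
    by (rule indep_vars_lebesgue_integral[OF _ ind int]) (simp add: L_def K)
  also have "\<dots> = pgf (count_mass (\<epsilon> i)) s * (\<Prod>j\<in>pa E i. \<Prod>l = 1..x j. 1 - A i j + A i j * s)"
  proof -
    have "expectation (\<lambda>\<omega>. s ^ B i j l \<omega>) = 1 - A i j + A i j * s" if "j \<in> pa E i" "l \<in> {1..x j}" for j l
      using that coeff_edge[of j i]
      by (intro expectation_power_bernoulli measurable_offspring offspring_bernoulli) (auto simp: pa_def)
    moreover have "expectation (\<lambda>\<omega>. s ^ \<epsilon> i \<omega>) = pgf (count_mass (\<epsilon> i)) s"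
      using measurable_exogenous[OF i] s by (rule pgf_count_mass(1)[symmetric])
    ultimately show ?thesis 
      unfolding prodL by (intro arg_cong2[of _ _ _ _ "(*)"] prod.cong refl) (simp_all add: noise_def)
  qed
  finally show ?thesis by simp
qed

text \<open>By acyclicity, \<open>X = x\<close> holds almost surely exactly when the row sums taken at \<open>x\<close> reproduce \<open>x\<close>,
  and distinct rows involve disjoint sets of noise variables.\<close>
lemma prob_state:
  "prob {\<omega> \<in> space M. \<forall>i\<in>{1..d}. X i \<omega> = x i} = (\<Prod>i\<in>{1..d}. count_mass (row_sum i x) (x i))"
proof -
  have "AE \<omega> in M. \<forall>i\<in>{1..d}. X i \<omega> = row_sum i (\<lambda>j. X j \<omega>) \<omega>"
    using structural_equation by (intro AE_finite_allI) (auto simp: row_sum_def thinning_def add.commute)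
  then have "AE \<omega> in M. (\<forall>i\<in>{1..d}. X i \<omega> = x i) \<longleftrightarrow> (\<forall>i\<in>{1..d}. row_sum i x \<omega> = x i)"
  proof eventually_elim
    case (elim \<omega>)
    have cong: "row_sum i (\<lambda>j. X j \<omega>) \<omega> = row_sum i x \<omega>" if "\<And>j. j \<in> pa E i \<Longrightarrow> X j \<omega> = x j" for i
      using that by (simp add: row_sum_def cong: sum.cong)
    have wf: "wf E"
      using dag finite_subset[OF edges] by (intro finite_acyclic_wf) auto
    show ?case
    proof
      assume X: "\<forall>i\<in>{1..d}. X i \<omega> = x i"
      show "\<forall>i\<in>{1..d}. row_sum i x \<omega> = x i"
        using elim X cong pa_subset by (metis subsetD)
    next
      assume Z: "\<forall>i\<in>{1..d}. row_sum i x \<omega> = x i"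
      \<comment> \<open>Parents come first: once they agree with x, the row sum at the random state
        is the row sum at x.\<close>
      have "i \<in> {1..d} \<longrightarrow> X i \<omega> = x i" for i
      proof (induction i rule: wf_induct_rule[OF wf])
        case (1 i)
        have "X j \<omega> = x j" if j: "j \<in> pa E i" for j
        proof -
          have "(j, i) \<in> E" "j \<in> {1..d}" using j edges by (auto simp: pa_def)
          then show ?thesis using 1 by blast
        qed
        from cong[OF this] show ?case using elim Z by simp
      qed
      then show "\<forall>i\<in>{1..d}. X i \<omega> = x i" by blast
    qed
  qed
  moreover have "{\<omega> \<in> space M. \<forall>i\<in>{1..d}. X i \<omega> = x i} \<in> events"
    by (intro sets.sets_Collect_finite_All) (use X_measurable in auto)
  moreover have Z: "{\<omega> \<in> space M. \<forall>i\<in>{1..d}. row_sum i x \<omega> = x i} \<in> events"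
    by (intro sets.sets_Collect_finite_All) (use measurable_row_sum in auto)
  ultimately have "prob {\<omega> \<in> space M. \<forall>i\<in>{1..d}. X i \<omega> = x i} = prob {\<omega> \<in> space M. \<forall>i\<in>{1..d}. row_sum i x \<omega> = x i}"
    by (intro measure_eq_AE) auto
  also have "\<dots> = (\<Prod>i\<in>{1..d}. count_mass (row_sum i x) (x i))"
  \<comment> \<open>Over no nodes the intersection of events used below would be UNIV instead of
    \<open>space M\<close>.\<close>
  proof (cases "d = 0")
    case True
    then show ?thesis by (simp add: prob_space)
  next
    case False
    define g where "g i f = f (Inl i) + (\<Sum>j\<in>pa E i. \<Sum>l = 1..x j. f (Inr (i, j, l)))" for i and f :: "nat + nat \<times> nat \<times> nat \<Rightarrow> nat"
    have disj: "disjoint_family_on row {1..d}" by (auto simp: disjoint_family_on_def row_def)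
    have "indep_vars (\<lambda>i. Pi\<^sub>M (row i) (\<lambda>_. count_space UNIV)) (\<lambda>i \<omega>. restrict (\<lambda>k. noise k \<omega>) (row i)) {1..d}"
      by (rule indep_vars_restrict[OF indep_noise row_subset disj])
    then have "indep_vars (\<lambda>_. count_space UNIV) (\<lambda>i \<omega>. g i (restrict (\<lambda>k. noise k \<omega>) (row i))) {1..d}"
    proof (rule indep_vars_compose2)
      show "g i \<in> measurable (Pi\<^sub>M (row i) (\<lambda>_. count_space UNIV)) (count_space UNIV)" if "i \<in> {1..d}" for i
        unfolding g_def[abs_def]
        by (intro measurable_nat_add measurable_nat_sum measurable_component_singleton) (auto simp: row_def pa_def)
    qed
    moreover have "g i (restrict (\<lambda>k. noise k \<omega>) (row i)) = row_sum i x \<omega>" for i \<omega>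
      unfolding g_def row_sum_def
      by (intro arg_cong2[of _ _ _ _ "(+)"] sum.cong) (auto simp: row_def noise_def pa_def)
    ultimately have "indep_vars (\<lambda>_. count_space UNIV) (\<lambda>i. row_sum i x) {1..d}"
      by simp
    then have "prob (\<Inter>i\<in>{1..d}. row_sum i x -` {x i} \<inter> space M) = (\<Prod>i\<in>{1..d}. prob (row_sum i x -` {x i} \<inter> space M))"
      by (rule indep_varsD) (use False in auto)
    moreover have "(\<Inter>i\<in>{1..d}. row_sum i x -` {x i} \<inter> space M) = {\<omega> \<in> space M. \<forall>i\<in>{1..d}. row_sum i x \<omega> = x i}"
      using False by auto
    moreover have "row_sum i x -` {x i} \<inter> space M = {\<omega> \<in> space M. row_sum i x \<omega> = x i}" for i by auto
    ultimately show ?thesis by (simp add: count_mass_def)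
  qed
  finally show ?thesis .
qed

text \<open>W is closed under parents, so its row sums involve coordinates in W only. Summing first
  over the coordinate of a sink i, \<open>pgf_row_sum\<close> yields the generating function of the
  noise of i and scales the other arguments as in \<open>joint_pgf_remove_sink\<close>; induction
  treats \<open>W - {i}\<close>.\<close>

lemma state_has_sum_joint_pgf:
  assumes "W \<subseteq> {1..d}" "\<And>i. i \<in> W \<Longrightarrow> pa E i \<subseteq> W" "\<And>k. \<bar>s k\<bar> \<le> 1"
  shows "((\<lambda>x. \<Prod>i\<in>W. count_mass (row_sum i x) (x i) * s i ^ x i) has_sum
    joint_pgf W (E \<inter> W \<times> W) A (\<lambda>i. count_mass (\<epsilon> i)) s) (PiE W (\<lambda>_. UNIV))"
  using assms
proof (induction "card W" arbitrary: W s)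
  case 0
  then have W: "W = {}" using finite_subset[of W "{1..d}"] by auto
  show ?case
    using has_sum_finite[of "{\<lambda>_. undefined}" "\<lambda>x::nat \<Rightarrow> nat. 1::real"] by (simp add: W joint_pgf_def)
next
  case (Suc n)
  interpret W: thinning_dag W "E \<inter> W \<times> W" A "\<lambda>i. count_mass (\<epsilon> i)"
    using Suc.prems(1) by (rule thinning_dag_restrict)
  have "W \<noteq> {}" using Suc.hyps(2) by auto
  then obtain i where i: "i \<in> W" "\<not> nonsink (E \<inter> W \<times> W) i" using W.ex_sink by blast
  have iV: "i \<in> {1..d}" using i(1) Suc.prems(1) by blast
  define W' where "W' = W - {i}"
  have W: "W = insert i W'" "i \<notin> W'" "finite W'" using i(1) W.finite_V by (auto simp: W'_def)
  have ipa: "i \<notin> pa E j" if "j \<in> W" for j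
    using i that by (auto simp: nonsink_def pa_def)
  have E': "E \<inter> W \<times> W - UNIV \<times> {i} = E \<inter> W' \<times> W'"
    using i by (auto simp: W'_def nonsink_def)
  have paW': "pa E j \<subseteq> W'" if "j \<in> W" for j
    using Suc.prems(2)[OF that] ipa[OF that] by (auto simp: W'_def)
  \<comment> \<open>\<open>F\<close> is the summand with the coordinate at i split off as n, and
    \<open>T\<close> the summand over the remaining nodes.\<close>
  define F where "F s = (\<lambda>(y, n). \<Prod>j\<in>W. count_mass (row_sum j (y(i := n))) ((y(i := n)) j) * s j ^ (y(i := n)) j)"
    for s :: "nat \<Rightarrow> real"
  define T where "T s y = (\<Prod>j\<in>W'. count_mass (row_sum j y) (y j) * s j ^ y j)" for s :: "nat \<Rightarrow> real" and y
  define s' where "s' s j = s j * (1 - A i j + A i j * s i)" for s j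
  have F: "F s (y, n) = T s y * (count_mass (row_sum i y) n * s i ^ n)" for s y n
  proof -
    have "row_sum j (y(i := n)) = row_sum j y" if "j \<in> W" for j
    proof -
      have "(\<Sum>k\<in>pa E j. \<Sum>l = 1..(y(i := n)) k. B j k l \<omega>) = (\<Sum>k\<in>pa E j. \<Sum>l = 1..y k. B j k l \<omega>)" for \<omega>
        by (rule sum.cong[OF refl]) (use ipa[OF that] in auto)
      then show ?thesis by (simp add: row_sum_def fun_eq_iff)
    qed
    note rows = this
    have "(\<Prod>j\<in>W'. count_mass (row_sum j (y(i := n))) ((y(i := n)) j) * s j ^ (y(i := n)) j) = T s y"
      unfolding T_def by (rule prod.cong) (use rows W in auto)
    then show ?thesis
      unfolding F_def W(1) using W(2,3) rows[OF i(1)] by (simp add: mult.commute)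
  qed
  have s'1: "\<bar>s' s k\<bar> \<le> 1" if "k \<in> W" "\<And>k. \<bar>s k\<bar> \<le> 1" for s k
  proof -
    have a: "0 \<le> A i k" "A i k \<le> 1"
      using W.coeff_edge[of k i] W.coeff_nonedge[OF i(1) that(1)] by fastforce+
    have "\<bar>A i k * s i\<bar> \<le> A i k" using a that(2)[of i] by (simp add: abs_mult mult_left_le)
    then have "\<bar>1 - A i k + A i k * s i\<bar> \<le> 1" using a by linarith
    then show ?thesis unfolding s'_def abs_mult using that(2) by (intro mult_le_one) auto
  qed
  have inner: "((\<lambda>n. F s (y, n)) has_sum (pgf (count_mass (\<epsilon> i)) (s i) * T (s' s) y)) UNIV"
    if s: "\<And>k. \<bar>s k\<bar> \<le> 1" for s y
  proof -
    \<comment> \<open>The product extends from the parents to all of \<open>W'\<close>, since the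
      coefficients of nonparents are 0.\<close>
    have "(\<Prod>j\<in>pa E i. (1 - A i j + A i j * s i) ^ y j) = (\<Prod>j\<in>W'. (1 - A i j + A i j * s i) ^ y j)"
    proof (rule prod.mono_neutral_left)
      show "\<forall>j\<in>W' - pa E i. (1 - A i j + A i j * s i) ^ y j = 1"
        using W.coeff_nonedge[OF i(1)] by (auto simp: W'_def pa_def)
    qed (use W paW' i in auto)
    then have "T s y * pgf (count_mass (row_sum i y)) (s i) = pgf (count_mass (\<epsilon> i)) (s i) * T (s' s) y"
      unfolding pgf_row_sum[OF iV s] T_def s'_def by (simp add: prod.distrib power_mult_distrib)
    then show ?thesis
      unfolding F using has_sum_cmult_right[OF pgf_count_mass_has_sum[OF measurable_row_sum[OF iV] s], of "T s y"]
      by metis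
  qed
  have outer: "((\<lambda>y. pgf (count_mass (\<epsilon> i)) (s i) * T (s' s) y) has_sum
      joint_pgf W (E \<inter> W \<times> W) A (\<lambda>i. count_mass (\<epsilon> i)) s) (PiE W' (\<lambda>_. UNIV))"
    if s: "\<And>k. \<bar>s k\<bar> \<le> 1" for s
  proof -
    \<comment> \<open>\<open>s' s\<close> is bounded by 1 only on W, whereas the induction
      hypothesis wants a bound at every index; outside W it is replaced by 0.\<close>
    define r where "r k = (if k \<in> W then s' s k else 0)" for k
    interpret W': thinning_dag W' "E \<inter> W' \<times> W'" A "\<lambda>i. count_mass (\<epsilon> i)"
      using Suc.prems(1) by (intro thinning_dag_restrict) (auto simp: W'_def)
    have rT: "T r y = T (s' s) y" for y unfolding T_def r_def by (intro prod.cong) (auto simp: W'_def)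
    have rG: "joint_pgf W' (E \<inter> W' \<times> W') A (\<lambda>i. count_mass (\<epsilon> i)) r =
        joint_pgf W' (E \<inter> W' \<times> W') A (\<lambda>i. count_mass (\<epsilon> i)) (s' s)"
    proof -
      have "W'.u r j = W'.u (s' s) j" if "j \<in> W'" for j
      proof (rule W'.u_cong)
        fix k assume "(j, k) \<in> (E \<inter> W' \<times> W')\<^sup>*"
        then have "k \<in> W'" using that by (induction rule: rtrancl_induct) auto
        then show "r k = s' s k" by (simp add: r_def W'_def)
      qed
      then show ?thesis unfolding joint_pgf_def by simp
    qed
    have "((\<lambda>x. \<Prod>i\<in>W'. count_mass (row_sum i x) (x i) * r i ^ x i) has_sum
        joint_pgf W' (E \<inter> W' \<times> W') A (\<lambda>i. count_mass (\<epsilon> i)) r) (PiE W' (\<lambda>_. UNIV))"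
    proof (rule Suc.hyps(1))
      show "n = card W'" using Suc.hyps(2) W by simp
      show "W' \<subseteq> {1..d}" using Suc.prems(1) by (auto simp: W'_def)
      show "pa E j \<subseteq> W'" if "j \<in> W'" for j using paW'[of j] that by (auto simp: W'_def)
      show "\<bar>r k\<bar> \<le> 1" for k using s'1[OF _ s] by (simp add: r_def)
    qed
    then have "(T (s' s) has_sum joint_pgf W' (E \<inter> W' \<times> W') A (\<lambda>i. count_mass (\<epsilon> i)) (s' s)) (PiE W' (\<lambda>_. UNIV))"
      unfolding rG T_def[symmetric] rT .
    from has_sum_cmult_right[OF this, of "pgf (count_mass (\<epsilon> i)) (s i)"] show ?thesis
      unfolding W.joint_pgf_remove_sink[OF i] E' s'_def[abs_def] W'_def[symmetric] .
  qed
  \<comment> \<open>Absolute values turn \<open>F s\<close> into \<open>F\<close> at the absolute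
    values of s, whose iterated sums are known from \<open>inner\<close> and \<open>outer\<close>.
    Hence \<open>F s\<close> is summable on the product, and its sum there is the iterated
    one.\<close>
  have abs: "\<bar>F s z\<bar> = F (\<lambda>k. \<bar>s k\<bar>) z" for z
    by (cases z) (simp add: F_def abs_prod abs_mult power_abs count_mass_nonneg)
  have "F (\<lambda>k. \<bar>s k\<bar>) summable_on Sigma (PiE W' (\<lambda>_. UNIV)) (\<lambda>_. UNIV)"
  proof (rule summable_on_SigmaI)
    show "((\<lambda>n. F (\<lambda>k. \<bar>s k\<bar>) (y, n)) has_sum (pgf (count_mass (\<epsilon> i)) (\<bar>s i\<bar>) * T (s' (\<lambda>k. \<bar>s k\<bar>)) y)) UNIV" for y
      using inner[of "\<lambda>k. \<bar>s k\<bar>" y] Suc.prems(3) by simp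
    show "(\<lambda>y. pgf (count_mass (\<epsilon> i)) (\<bar>s i\<bar>) * T (s' (\<lambda>k. \<bar>s k\<bar>)) y) summable_on PiE W' (\<lambda>_. UNIV)"
      using outer[of "\<lambda>k. \<bar>s k\<bar>"] Suc.prems(3) by (auto simp: summable_on_def)
    show "0 \<le> F (\<lambda>k. \<bar>s k\<bar>) (y, n)" for y n using abs[of "(y, n)"] by (metis abs_ge_zero)
  qed
  then have "F s summable_on Sigma (PiE W' (\<lambda>_. UNIV)) (\<lambda>_. UNIV)"
    unfolding summable_on_iff_abs_summable_on_real[of "F s"] real_norm_def abs .
  from has_sum_SigmaI[OF inner[OF Suc.prems(3)] outer[OF Suc.prems(3)] this]
  have "(F s has_sum joint_pgf W (E \<inter> W \<times> W) A (\<lambda>i. count_mass (\<epsilon> i)) s) (PiE W' (\<lambda>_. UNIV) \<times> UNIV)" .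
  \<comment> \<open>States on \<open>W'\<close> are extensional and take the value
    \<open>undefined\<close> at i, so the inverse resets that coordinate.\<close>
  moreover have "bij_betw (\<lambda>(y, n). y(i := n)) (PiE W' (\<lambda>_. UNIV) \<times> (UNIV :: nat set)) (PiE W (\<lambda>_. UNIV))"
    by (rule bij_betw_byWitness[where f' = "\<lambda>x. (x(i := undefined), x i)"])
      (use W in \<open>auto simp: PiE_def extensional_def fun_eq_iff\<close>)
  from has_sum_reindex_bij_betw[OF this, of "\<lambda>x. \<Prod>j\<in>W. count_mass (row_sum j x) (x j) * s j ^ x j"]
  have "(F s has_sum S) (PiE W' (\<lambda>_. UNIV) \<times> UNIV) \<longleftrightarrow>
      ((\<lambda>x. \<Prod>j\<in>W. count_mass (row_sum j x) (x j) * s j ^ x j) has_sum S) (PiE W (\<lambda>_. UNIV))" for S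
    by (simp add: F_def case_prod_unfold)
  ultimately show ?case by simp
qed

text \<open>The bridge from probability to algebra: \<open>prob_state\<close> factors the state
  probabilities, and the sum over states identifies \<open>joint_pgf\<close> as the joint generating
  function of X.\<close>

lemma joint_pgf_has_sum:
  assumes "\<And>k. \<bar>s k\<bar> \<le> 1"
  shows "((\<lambda>x. prob {\<omega> \<in> space M. \<forall>i\<in>{1..d}. X i \<omega> = x i} * (\<Prod>i\<in>{1..d}. s i ^ x i)) has_sum
    joint_pgf {1..d} E A (\<lambda>i. count_mass (\<epsilon> i)) s) (PiE {1..d} (\<lambda>_. UNIV))"
proof -
  have "E \<inter> {1..d} \<times> {1..d} = E" using edges by blast
  with state_has_sum_joint_pgf[OF order_refl pa_subset, of s] assms show ?thesis
    unfolding prob_state prod.distrib[symmetric] by (simp only:)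
qed

lemma measure_observational_law:
  assumes "x \<in> PiE {1..d} (\<lambda>_. UNIV)"
  shows "measure (observational_law M d X) {x} = prob {\<omega> \<in> space M. \<forall>i\<in>{1..d}. X i \<omega> = x i}"
proof -
  have "(\<lambda>\<omega>. \<lambda>i\<in>{1..d}. X i \<omega>) \<in> measurable M (\<Pi>\<^sub>M i\<in>{1..d}. count_space UNIV)"
    by (rule measurable_restrict[OF X_measurable])
  moreover have "{x} \<in> sets (\<Pi>\<^sub>M i\<in>{1..d}. count_space UNIV)"
  proof -
    have "PiE {1..d} (\<lambda>i. {x i}) = {x}" using assms by (intro PiE_singleton) (auto simp: PiE_def)
    then show ?thesis
      using sets_PiM_I_finite[of "{1..d}" "\<lambda>i. {x i}" "\<lambda>_. count_space UNIV"] by simp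
  qed
  moreover have "(\<lambda>\<omega>. \<lambda>i\<in>{1..d}. X i \<omega>) -` {x} \<inter> space M = {\<omega> \<in> space M. \<forall>i\<in>{1..d}. X i \<omega> = x i}"
    using assms by (fastforce simp: PiE_def extensional_def fun_eq_iff)
  ultimately show ?thesis unfolding observational_law_def by (simp add: measure_distr)
qed

lemma poisson_distributedI:
  assumes i: "i \<in> {1..d}" and "poisson_mass (count_mass (\<epsilon> i))"
  shows "poisson_distributed M (\<epsilon> i)"
proof -
  obtain r where r: "r > 0" "\<And>n. count_mass (\<epsilon> i) n = r ^ n / fact n * exp (- r)"
    using assms(2) by (auto simp: poisson_mass_def)
  have "law M (\<epsilon> i) = measure_pmf (poisson_pmf r)"
  proof (rule law_eqI[OF prob_space_axioms measure_pmf.prob_space_axioms measurable_exogenous[OF i]])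
    show "prob {\<omega> \<in> space M. \<epsilon> i \<omega> = n} = measure (measure_pmf (poisson_pmf r)) {n}" for n
      using r by (simp add: count_mass_def[symmetric] measure_pmf_single)
  qed simp
  with r(1) show ?thesis by (auto simp: poisson_distributed_def)
qed

end

section \<open>From equal observational laws to equal graphs, coefficients and exogenous
  laws\<close>

theorem theorem14:
  fixes M :: "'a measure" and M' :: "'b measure"
    and d :: nat
    and E E' :: "(nat \<times> nat) set"
    and A A' :: "nat \<Rightarrow> nat \<Rightarrow> real"
    and \<epsilon> X :: "nat \<Rightarrow> 'a \<Rightarrow> nat"
    and \<epsilon>' X' :: "nat \<Rightarrow> 'b \<Rightarrow> nat"
    and B :: "nat \<Rightarrow> nat \<Rightarrow> nat \<Rightarrow> 'a \<Rightarrow> nat"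
    and B' :: "nat \<Rightarrow> nat \<Rightarrow> nat \<Rightarrow> 'b \<Rightarrow> nat"
  assumes "binomial_thinning_sem M d E A \<epsilon> B X"
    and "binomial_thinning_sem M' d E' A' \<epsilon>' B' X'"
    and "\<And>i. i \<in> {1..d} \<Longrightarrow> nonsink E i \<Longrightarrow> \<not> poisson_distributed M (\<epsilon> i)"
    and "\<And>i. i \<in> {1..d} \<Longrightarrow> nonsink E' i \<Longrightarrow> \<not> poisson_distributed M' (\<epsilon>' i)"
    and "observational_law M d X = observational_law M' d X'"
  shows "E = E' \<and>
         (\<forall>i\<in>{1..d}. \<forall>j\<in>{1..d}. A i j = A' i j) \<and>
         (\<forall>i\<in>{1..d}. law M (\<epsilon> i) = law M' (\<epsilon>' i))"
proof -
  interpret S: binomial_thinning_sem M d E A \<epsilon> B X by fact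
  interpret S': binomial_thinning_sem M' d E' A' \<epsilon>' B' X' by fact
  let ?V = "{1..d}"
  have "E \<inter> ?V \<times> ?V = E" "E' \<inter> ?V \<times> ?V = E'" using S.edges S'.edges by blast+
  then interpret D: thinning_dag ?V E A "\<lambda>i. S.count_mass (\<epsilon> i)" + D': thinning_dag ?V E' A' "\<lambda>i. S'.count_mass (\<epsilon>' i)"
    using S.thinning_dag_restrict[of ?V] S'.thinning_dag_restrict[of ?V] by simp_all
  have "thinning_dag_pair ?V E A (\<lambda>i. S.count_mass (\<epsilon> i)) E' A' (\<lambda>i. S'.count_mass (\<epsilon>' i))"
  proof
    fix s :: "nat \<Rightarrow> real" assume s: "\<And>k. \<bar>s k\<bar> \<le> 1"
    \<comment> \<open>Equal laws give equal state probabilities, so both joint generating functions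
      are the value of the same unordered sum.\<close>
    have "S.prob {\<omega> \<in> space M. \<forall>i\<in>?V. X i \<omega> = x i} = S'.prob {\<omega> \<in> space M'. \<forall>i\<in>?V. X' i \<omega> = x i}"
      if "x \<in> PiE ?V (\<lambda>_. UNIV)" for x
      using S.measure_observational_law[OF that] S'.measure_observational_law[OF that] assms(5) by simp
    then have "((\<lambda>x. S.prob {\<omega> \<in> space M. \<forall>i\<in>?V. X i \<omega> = x i} * (\<Prod>i\<in>?V. s i ^ x i)) has_sum
        joint_pgf ?V E A (\<lambda>i. S.count_mass (\<epsilon> i)) s) (PiE ?V (\<lambda>_. UNIV)) \<longleftrightarrow>
      ((\<lambda>x. S'.prob {\<omega> \<in> space M'. \<forall>i\<in>?V. X' i \<omega> = x i} * (\<Prod>i\<in>?V. s i ^ x i)) has_sum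
        joint_pgf ?V E A (\<lambda>i. S.count_mass (\<epsilon> i)) s) (PiE ?V (\<lambda>_. UNIV))"
      by (intro has_sum_cong arg_cong2[of _ _ _ _ "(*)"] refl)
    then show "joint_pgf ?V E A (\<lambda>i. S.count_mass (\<epsilon> i)) s = joint_pgf ?V E' A' (\<lambda>i. S'.count_mass (\<epsilon>' i)) s"
      using S.joint_pgf_has_sum[of s, OF s] S'.joint_pgf_has_sum[of s, OF s] has_sum_unique by blast
  qed
  moreover have "\<not> poisson_mass (S'.count_mass (\<epsilon>' i))" if "i \<in> ?V" "nonsink E' i" for i
    using assms(4)[OF that] S'.poisson_distributedI[OF that(1)] by blast
  ultimately have *: "E = E' \<and> (\<forall>i\<in>?V. \<forall>j\<in>?V. A i j = A' i j) \<and>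
      (\<forall>i\<in>?V. S.count_mass (\<epsilon> i) = S'.count_mass (\<epsilon>' i))"
    by (rule thinning_dag_identifiable)
  have "law M (\<epsilon> i) = law M' (\<epsilon>' i)" if i: "i \<in> ?V" for i
  proof (rule law_eqI[OF S.prob_space_axioms _ S.measurable_exogenous[OF i]])
    have m: "\<epsilon>' i \<in> measurable M' (count_space UNIV)" by (rule S'.measurable_exogenous[OF i])
    then show "prob_space (law M' (\<epsilon>' i))" unfolding law_def by (rule S'.prob_space_distr)
    show "sets (law M' (\<epsilon>' i)) = UNIV" by (simp add: law_def)
    show "S.prob {\<omega> \<in> space M. \<epsilon> i \<omega> = n} = measure (law M' (\<epsilon>' i)) {n}" for n
    proof -
      have "S.count_mass (\<epsilon> i) n = S'.count_mass (\<epsilon>' i) n" using * i by simp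
      then show ?thesis
        using m by (simp add: law_def measure_distr S.count_mass_def S'.count_mass_def vimage_def Int_def conj_commute)
    qed
  qed
  with * show ?thesis by blast
qed

end
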